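(* In the setting described in the context, let $\gamma_A^u>0$ be the uplink SINR threshold and let $$\mathsf{SINR}^u_A=\frac{P_{AsD}\,G^u_A\,PL_a(Z_A)}{P_{TsUE}\,G^u_T\,PL_a(Z_T)+\sigma^2}$$ be the uplink SINR at the aerial base station. For $s\ge0$ let $$\mathcal L(s)=\int_{\sqrt{R_2^2+h^2}}^{\sqrt{(R_1-d)^2+h^2}}\int_0^{2\pi}\mathcal L(s|\omega,z)f_\Omega(\omega|z)f_{Z_T}(z)\,d\omega\,dz+\int_{\sqrt{(R_1-d)^2+h^2}}^{\sqrt{(R_1+d)^2+h^2}}\int_{-\widehat\omega}^{\widehat\omega}\mathcal L(s|\omega,z)f_\Omega(\omega|z)f_{Z_T}(z)\,d\omega\,dz,$$ $$\mathcal L(s|\omega,z)=\sum_{k\in\{L,N\}}p_k(z)\,m_k^{m_k}\left(m_k+s\rho_T\eta_k z^{-\alpha_k}\left(z^2-h^2+d^2-2\sqrt{z^2-h^2}\,d\cos\omega\right)^{\alpha_T/2}\right)^{-m_k},$$ where $\widehat\omega=\widehat\omega(z)=\mathrm{arcsec}\left(\frac{2d\sqrt{z^2-h^2}}{d^2+z^2-h^2-R_1^2}\right)$; for $\sqrt{R_2^2+h^2}\le z\le\sqrt{(R_1-d)^2+h^2}$, $f_{Z_T}(z)=\frac{2z}{R_1^2-R_2^2}$ and $f_\Omega(\omega|z)=\frac1{2\pi}$; for $\sqrt{(R_1-d)^2+h^2}<z\le\sqrt{(R_1+d)^2+h^2}$, $f_{Z_T}(z)=\frac{2z\widehat\omega}{\pi(R_1^2-R_2^2)}$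 and $f_\Omega(\omega|z)=\frac{1}{2\widehat\omega}$. For $k\in\{L,N\}$, $p>0$ and $z\ge h$ put $$\mathbb P^{u,k}(p|z)=p_k(z)\sum_{n=0}^{m_k-1}\frac{(-s_k)^n}{n!}e^{-s_k\sigma^2}\sum_{j=0}^n\binom nj(-\sigma^2)^{n-j}\mathcal L^{(j)}(s_k),\qquad s_k=\frac{m_k\gamma_A^u z^{\alpha_k}}{\eta_k p},$$ where $\mathcal L^{(j)}$ is the $j$-th derivative. Let $M=\sqrt{h^2+R_2^2}$, $f(z)=2z/R_2^2$, $D_k=(P_M\eta_k/\rho_A)^{1/\alpha_k}$, $E_k=\sqrt{D_k^2-R_2^2}$ (read as $0$ if $D_k<R_2$), and $$A_k(a,b)=\int_a^b\mathbb P^{u,k}\left(\tfrac{\rho_A}{\eta_k}z^{\alpha_k}\Big|z\right)f(z)\,dz,\qquad B_k(a,b)=\int_a^b\mathbb P^{u,k}(P_M|z)f(z)\,dz.$$ Then the uplink coverage probability $\mathbb P^{u,A}=\Pr(\mathsf{SINR}^u_A>\gamma^u_A)$ is: (i) if $h\ge D_L$: $\mathbb P^{u,A}=B_L(h,M)+B_N(h,M)$; (ii) if $E_L<D_N<h<D_L$ or $D_N<E_L\le h<D_L$: $\mathbb P^{u,A}=A_L(h,D_L)+B_L(D_L,M)+B_N(h,M)$; (iii) if $E_L<h\le D_N$: $\mathbb P^{u,A}=A_L(h,D_L)+B_L(D_L,M)+A_N(h,D_N)+B_N(D_N,M)$; (iv) if $D_N\le h<E_L$: $\mathbb P^{u,A}=A_L(h,M)+B_N(h,M)$;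 (v) if $E_N<h\le E_L<D_N$ or $E_N<h<D_N<E_L$: $\mathbb P^{u,A}=A_L(h,M)+A_N(h,D_N)+B_N(D_N,M)$; (vi) if $h\le E_N$: $\mathbb P^{u,A}=A_L(h,M)+A_N(h,M)$.
   Context: Geometry: a terrestrial base station (TBS) is at the center of a disk $\mathcal S_1$ of radius $R_1$ in the ground plane. A stadium is a disk $\mathcal S_2\subset\mathcal S_1$ of radius $R_2>0$ whose center is at distance $d>0$ from the TBS, with $d+R_2\le R_1$. An aerial base station (ABS) is at height $h>0$ above the center of $\mathcal S_2$. An ABS-supported device (AsD) is uniformly distributed on $\mathcal S_2$, and, independently, a TBS-supported user (TsUE) is uniformly distributed on $\mathcal S_1\setminus\mathcal S_2$. $Z_A$, $Z_T$ are the 3-D Euclidean distances from the AsD and from the TsUE to the ABS; $d_T$ is the distance from the TsUE to the TBS. Aerial links (AsD–ABS and TsUE–ABS): given the node positions, a link of length $z$ is, independently of the other link, line-of-sight (LOS, index $L$) with probability $p_L(z)\in[0,1]$ and non-line-of-sight (NLOS, index $N$) with probability $p_N(z)=1-p_L(z)$, where $p_L$ is a given measurable function. In state $k\in\{L,N\}$ the path-loss is $PL_a(z)=\eta_k z^{-\alpha_k}$, with $\alpha_k,\eta_k>0$, $\eta_L>\eta_N$, and NLOS attenuates more than LOS: $\eta_Lz^{-\alpha_L}>\eta_Nz^{-\alpha_N}$ for all $z\ge h$. Fading is Nakagami: in state $k$ the power gain ($G^u_A$ for the AsD, $G^u_T$ for the TsUE) is Gamma distributed with shape $m_k$ and mean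 $1$, where $m_L,m_N$ are positive integers. Fading gains are independent of each other and, given the link states, of the positions. Powers: the TsUE inverts its terrestrial path-loss (exponent $\alpha_T>0$) to reach sensitivity $\rho_T>0$ at the TBS: $P_{TsUE}=\rho_T d_T^{\alpha_T}$. The AsD inverts its aerial path-loss to reach sensitivity $\rho_A>0$ at the ABS, capped at $P_M>0$: in state $k$ of its link, $P_{AsD}=\min\{P_M,\rho_A Z_A^{\alpha_k}/\eta_k\}$. Noise power is $\sigma^2>0$. Convention: $\mathrm{arcsec}(x)=\arccos(1/x)\in[0,\pi]$, with $\mathrm{arcsec}(2dr/0)=\pi/2$. *)

theory Defs
  imports "HOL-Probability.Probability"
begin

datatype link_state = LOS | NLOS

text \<open>
  Points of the ground plane have type \<open>real \<times> real\<close>; points of space have type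
  \<open>(real \<times> real) \<times> real\<close>, the last component being the altitude. The metric of the product
  types is the Euclidean one, so \<open>dist\<close> is the Euclidean distance in two and three dimensions.
\<close>

record uplink =
  tbs :: "real \<times> real"
  stadium_center :: "real \<times> real"
  R\<^sub>1 :: real
  R\<^sub>2 :: real
  height :: real
  p\<^sub>L :: "real \<Rightarrow> real"
  \<alpha>\<^sub>a :: "link_state \<Rightarrow> real"
  \<eta>\<^sub>a :: "link_state \<Rightarrow> real"
  m\<^sub>a :: "link_state \<Rightarrow> nat"
  \<alpha>\<^sub>T :: real
  \<rho>\<^sub>T :: real
  \<rho>\<^sub>A :: real
  P\<^sub>M :: real
  noise_power :: real  \<comment> \<open>the quantity written \<open>\<sigma>\<^sup>2\<close>\<close>

definition center_dist :: "uplink \<Rightarrow> real" where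
  "center_dist N = dist (tbs N) (stadium_center N)"

definition cell :: "uplink \<Rightarrow> (real \<times> real) set" where
  "cell N = cball (tbs N) (R\<^sub>1 N)"

definition stadium :: "uplink \<Rightarrow> (real \<times> real) set" where
  "stadium N = cball (stadium_center N) (R\<^sub>2 N)"

definition abs_dist :: "uplink \<Rightarrow> real \<times> real \<Rightarrow> real" where
  "abs_dist N x = dist (x, 0) (stadium_center N, height N)"

definition link_prob :: "uplink \<Rightarrow> link_state \<Rightarrow> real \<Rightarrow> real" where
  "link_prob N k z = (case k of LOS \<Rightarrow> p\<^sub>L N z | NLOS \<Rightarrow> 1 - p\<^sub>L N z)"

definition path_loss :: "uplink \<Rightarrow> link_state \<Rightarrow> real \<Rightarrow> real" where
  "path_loss N k z = \<eta>\<^sub>a N k * z powr (- \<alpha>\<^sub>a N k)"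

text \<open>
  The Gamma distribution with shape \<open>m\<close> and mean \<open>1\<close>, hence rate \<open>m\<close>. As \<open>m\<close> is a positive integer,
  this is an Erlang distribution; the first argument of \<^const>\<open>erlang_density\<close> is the shape minus one.
\<close>
definition gain_distribution :: "uplink \<Rightarrow> link_state \<Rightarrow> real measure" where
  "gain_distribution N k =
     density lborel (\<lambda>g. ennreal (erlang_density (m\<^sub>a N k - 1) (real (m\<^sub>a N k)) g))"

definition P_TsUE :: "uplink \<Rightarrow> real \<times> real \<Rightarrow> real" where
  "P_TsUE N y = \<rho>\<^sub>T N * dist y (tbs N) powr \<alpha>\<^sub>T N"

definition P_AsD :: "uplink \<Rightarrow> link_state \<Rightarrow> real \<Rightarrow> real" where
  "P_AsD N k z = min (P\<^sub>M N) (\<rho>\<^sub>A N * z powr \<alpha>\<^sub>a N k / \<eta>\<^sub>a N k)"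

text \<open>
  The SINR as a function of the position, link state and power gain of the AsD (\<open>x\<close>, \<open>k\<close>, \<open>g\<close>) and
  of the TsUE (\<open>y\<close>, \<open>l\<close>, \<open>g'\<close>).
\<close>
definition SINR ::
  "uplink \<Rightarrow> real \<times> real \<Rightarrow> link_state \<Rightarrow> real \<Rightarrow> real \<times> real \<Rightarrow> link_state \<Rightarrow> real \<Rightarrow> real" where
  "SINR N x k g y l g' =
     P_AsD N k (abs_dist N x) * g * path_loss N k (abs_dist N x) /
     (P_TsUE N y * g' * path_loss N l (abs_dist N y) + noise_power N)"

text \<open>
  \<open>Pr\<close> is the underlying probability space; \<open>X\<close>, \<open>K\<close>, \<open>G\<close> are the positions, the states of the links
  to the ABS and the power gains, with index \<open>A\<close> for the AsD and \<open>T\<close> for the TsUE. The link states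
  are specified by their joint conditional law given the positions, the gains by their joint
  conditional law given the positions and the link states.
\<close>
locale uplink_model = prob_space Pr
  for Pr :: "'w measure" +
  fixes N :: uplink
    and X\<^sub>A X\<^sub>T :: "'w \<Rightarrow> real \<times> real"
    and K\<^sub>A K\<^sub>T :: "'w \<Rightarrow> link_state"
    and G\<^sub>A G\<^sub>T :: "'w \<Rightarrow> real"
  assumes R2_pos: "R\<^sub>2 N > 0"
    and center_dist_pos: "center_dist N > 0"
    and stadium_in_cell: "center_dist N + R\<^sub>2 N \<le> R\<^sub>1 N"
    and height_pos: "height N > 0"
    and p_L_measurable: "p\<^sub>L N \<in> borel_measurable (restrict_space borel {height N..})"
    and p_L_range: "\<And>z. z \<ge> height N \<Longrightarrow> 0 \<le> p\<^sub>L N z \<and> p\<^sub>L N z \<le> 1"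
    and alpha_pos: "\<And>k. \<alpha>\<^sub>a N k > 0"
    and eta_pos: "\<And>k. \<eta>\<^sub>a N k > 0"
    and eta_less: "\<eta>\<^sub>a N LOS > \<eta>\<^sub>a N NLOS"
    and NLOS_attenuates_more: "\<And>z. z \<ge> height N \<Longrightarrow> path_loss N LOS z > path_loss N NLOS z"
    and m_pos: "\<And>k. m\<^sub>a N k > 0"
    and alpha_T_pos: "\<alpha>\<^sub>T N > 0"
    and rho_T_pos: "\<rho>\<^sub>T N > 0"
    and rho_A_pos: "\<rho>\<^sub>A N > 0"
    and P_M_pos: "P\<^sub>M N > 0"
    and noise_pos: "noise_power N > 0"
    and X_measurable: "random_variable borel X\<^sub>A" "random_variable borel X\<^sub>T"
    and K_measurable: "random_variable (count_space UNIV) K\<^sub>A" "random_variable (count_space UNIV) K\<^sub>T"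
    and G_measurable: "random_variable borel G\<^sub>A" "random_variable borel G\<^sub>T"
    and AsD_uniform: "distr Pr borel X\<^sub>A = uniform_measure lborel (stadium N)"
    and TsUE_uniform: "distr Pr borel X\<^sub>T = uniform_measure lborel (cell N - stadium N)"
    and positions_indep: "indep_var borel X\<^sub>A borel X\<^sub>T"
    and link_states_given_positions:
      "\<And>k l. AE w in Pr.
         real_cond_exp Pr
           (vimage_algebra (space Pr) (\<lambda>w. (X\<^sub>A w, X\<^sub>T w)) (borel \<Otimes>\<^sub>M borel))
           (indicator {w \<in> space Pr. K\<^sub>A w = k \<and> K\<^sub>T w = l}) w
         = link_prob N k (abs_dist N (X\<^sub>A w)) * link_prob N l (abs_dist N (X\<^sub>T w))"
    and gains_given_positions_and_states:
      "\<And>U V. U \<in> sets borel \<Longrightarrow> V \<in> sets borel \<Longrightarrow> AE w in Pr.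
         real_cond_exp Pr
           (vimage_algebra (space Pr) (\<lambda>w. ((X\<^sub>A w, X\<^sub>T w), (K\<^sub>A w, K\<^sub>T w)))
             ((borel \<Otimes>\<^sub>M borel) \<Otimes>\<^sub>M (count_space UNIV \<Otimes>\<^sub>M count_space UNIV)))
           (indicator {w \<in> space Pr. G\<^sub>A w \<in> U \<and> G\<^sub>T w \<in> V}) w
         = measure (gain_distribution N (K\<^sub>A w)) U * measure (gain_distribution N (K\<^sub>T w)) V"

definition arcsec :: "real \<Rightarrow> real" where
  "arcsec x = arccos (1 / x)"

text \<open>
  If the denominator below vanishes, division by zero yields \<open>arccos 0 = pi / 2\<close>, which is the
  intended value.
\<close>
definition omega_hat :: "uplink \<Rightarrow> real \<Rightarrow> real" where
  "omega_hat N z =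
     arcsec (2 * center_dist N * sqrt (z\<^sup>2 - (height N)\<^sup>2) /
             ((center_dist N)\<^sup>2 + z\<^sup>2 - (height N)\<^sup>2 - (R\<^sub>1 N)\<^sup>2))"

text \<open>
  The densities \<open>f_ZT\<close> and \<open>f_Omega\<close> are only used for
  \<open>sqrt (R\<^sub>2\<^sup>2 + h\<^sup>2) \<le> z \<le> sqrt ((R\<^sub>1 + d)\<^sup>2 + h\<^sup>2)\<close>, and \<open>f_Omega\<close> only for angles in the
  respective range of integration.
\<close>
definition f_ZT :: "uplink \<Rightarrow> real \<Rightarrow> real" where
  "f_ZT N z =
     (if z \<le> sqrt ((R\<^sub>1 N - center_dist N)\<^sup>2 + (height N)\<^sup>2)
      then 2 * z / ((R\<^sub>1 N)\<^sup>2 - (R\<^sub>2 N)\<^sup>2)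
      else 2 * z * omega_hat N z / (pi * ((R\<^sub>1 N)\<^sup>2 - (R\<^sub>2 N)\<^sup>2)))"

definition f_Omega :: "uplink \<Rightarrow> real \<Rightarrow> real \<Rightarrow> real" where
  "f_Omega N \<omega> z =
     (if z \<le> sqrt ((R\<^sub>1 N - center_dist N)\<^sup>2 + (height N)\<^sup>2)
      then 1 / (2 * pi)
      else 1 / (2 * omega_hat N z))"

definition cond_laplace :: "uplink \<Rightarrow> real \<Rightarrow> real \<Rightarrow> real \<Rightarrow> real" where
  "cond_laplace N s \<omega> z =
     (\<Sum>k\<in>{LOS, NLOS}. link_prob N k z * real (m\<^sub>a N k) ^ m\<^sub>a N k *
        (real (m\<^sub>a N k) + s * \<rho>\<^sub>T N * \<eta>\<^sub>a N k * z powr (- \<alpha>\<^sub>a N k) *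
           (z\<^sup>2 - (height N)\<^sup>2 + (center_dist N)\<^sup>2
             - 2 * sqrt (z\<^sup>2 - (height N)\<^sup>2) * center_dist N * cos \<omega>) powr (\<alpha>\<^sub>T N / 2))
          powi (- int (m\<^sub>a N k)))"

definition laplace :: "uplink \<Rightarrow> real \<Rightarrow> real" where
  "laplace N s =
     (LBINT z = sqrt ((R\<^sub>2 N)\<^sup>2 + (height N)\<^sup>2) ..
                sqrt ((R\<^sub>1 N - center_dist N)\<^sup>2 + (height N)\<^sup>2).
        (LBINT \<omega> = 0 .. 2 * pi. cond_laplace N s \<omega> z * f_Omega N \<omega> z * f_ZT N z)) +
     (LBINT z = sqrt ((R\<^sub>1 N - center_dist N)\<^sup>2 + (height N)\<^sup>2) ..
                sqrt ((R\<^sub>1 N + center_dist N)\<^sup>2 + (height N)\<^sup>2).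
        (LBINT \<omega> = - omega_hat N z .. omega_hat N z.
           cond_laplace N s \<omega> z * f_Omega N \<omega> z * f_ZT N z))"

definition s_arg :: "uplink \<Rightarrow> real \<Rightarrow> link_state \<Rightarrow> real \<Rightarrow> real \<Rightarrow> real" where
  "s_arg N \<gamma> k p z = real (m\<^sub>a N k) * \<gamma> * z powr \<alpha>\<^sub>a N k / (\<eta>\<^sub>a N k * p)"

text \<open>The function \<open>\<P>\<^bsup>u,k\<^esup>(p|z)\<close>, for transmit power \<open>p\<close>, link length \<open>z\<close> and SINR threshold \<open>\<gamma>\<close>.\<close>
definition cond_coverage :: "uplink \<Rightarrow> real \<Rightarrow> link_state \<Rightarrow> real \<Rightarrow> real \<Rightarrow> real" where
  "cond_coverage N \<gamma> k p z =
     (let s = s_arg N \<gamma> k p z in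
      link_prob N k z *
      (\<Sum>n = 0..m\<^sub>a N k - 1. (- s) ^ n / fact n * exp (- s * noise_power N) *
         (\<Sum>j = 0..n. real (n choose j) * (- noise_power N) ^ (n - j) *
            (deriv ^^ j) (laplace N) s)))"

definition max_length :: "uplink \<Rightarrow> real" where
  "max_length N = sqrt ((height N)\<^sup>2 + (R\<^sub>2 N)\<^sup>2)"

definition f_ZA :: "uplink \<Rightarrow> real \<Rightarrow> real" where
  "f_ZA N z = 2 * z / (R\<^sub>2 N)\<^sup>2"

definition D_lim :: "uplink \<Rightarrow> link_state \<Rightarrow> real" where
  "D_lim N k = (P\<^sub>M N * \<eta>\<^sub>a N k / \<rho>\<^sub>A N) powr (1 / \<alpha>\<^sub>a N k)"

definition E_lim :: "uplink \<Rightarrow> link_state \<Rightarrow> real" where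
  "E_lim N k = (if D_lim N k < R\<^sub>2 N then 0 else sqrt ((D_lim N k)\<^sup>2 - (R\<^sub>2 N)\<^sup>2))"

definition A_int :: "uplink \<Rightarrow> real \<Rightarrow> link_state \<Rightarrow> real \<Rightarrow> real \<Rightarrow> real" where
  "A_int N \<gamma> k a b =
     (LBINT z = a .. b.
        cond_coverage N \<gamma> k (\<rho>\<^sub>A N / \<eta>\<^sub>a N k * z powr \<alpha>\<^sub>a N k) z * f_ZA N z)"

definition B_int :: "uplink \<Rightarrow> real \<Rightarrow> link_state \<Rightarrow> real \<Rightarrow> real \<Rightarrow> real" where
  "B_int N \<gamma> k a b = (LBINT z = a .. b. cond_coverage N \<gamma> k (P\<^sub>M N) z * f_ZA N z)"

end

theory Submission
  imports Defs
begin

text \<open>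
  The two transmitters, each described by its position, link state and gain, are independent, so the
  coverage probability is the expectation, over the AsD position and link state, of the Gamma tail
  evaluated at \<open>s\<^sub>k (I + \<sigma>\<^sup>2)\<close>, where \<open>I\<close> is the interference. An integer shape makes the tail a
  finite Poisson sum, whose expectation involves \<open>E[(- I)\<^sup>j exp (- s I)]\<close>, the \<open>j\<close>-th derivative of
  the Laplace transform of \<open>I\<close>. That transform becomes \<open>\<L>\<close> in polar coordinates around the stadium
  centre, where \<open>z\<^sup>2 = r\<^sup>2 + h\<^sup>2\<close> gives \<open>z dz = r dr\<close> and the law of cosines gives the distance to the
  TBS. In state \<open>k\<close> the power cap is active exactly for links longer than \<open>D\<^sub>k\<close>, and
  \<open>D\<^sub>k \<le> M\<close> iff \<open>E\<^sub>k \<le> h\<close>; stronger NLOS attenuation forces \<open>D\<^sub>N < D\<^sub>L\<close> once \<open>D\<^sub>N \<ge> h\<close>.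
\<close>

section \<open>Polar coordinates\<close>

text \<open>Three obstacles shape the development. The hypotheses on link states and gains are
  almost sure identities between conditional expectations, so the independence of the transmitters
  has to be extracted from them: two uses of the tower property give the joint law on rectangles,
  and uniqueness of measures extends it. \<open>cond_coverage\<close> applies the total operator
  \<open>deriv\<close> repeatedly, and a derivative depends on a whole neighbourhood; hence
  \<open>laplace N\<close> is identified with a genuine Laplace transform at every positive
  argument, not merely at the points where it is evaluated. Finally, integrals stay in
  \<open>ennreal\<close>, where Tonelli and substitution ask for no integrability, and interval
  integrals are reached through \<open>interval_integral_eq_enn2real\<close>. The cap remains inside
  the minimum of \<open>P_AsD\<close> until the final case distinction.\<close>

lemma borel_measurable_tan [measurable]: "tan \<in> borel_measurable (borel :: real measure)"
  unfolding tan_def by measurable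

text \<open>On the open strip tan is a bijection onto the line with derivative 1/cos^2, so the
  weighted mass of the preimage of (l, u) is tan (arctan u) - tan (arctan l). Phrasing the
  substitution as an image measure handles the unbounded range without exhausting it by compact
  intervals.\<close>

lemma lborel_eq_distr_tan:
  "lborel = distr (density lborel (\<lambda>\<theta>. ennreal (inverse ((cos \<theta>)\<^sup>2)) * indicator {-(pi/2)<..<pi/2} \<theta>)) borel tan"
proof (rule lborel_eqI)
  fix l u :: real
  assume "\<And>b. b \<in> Basis \<Longrightarrow> l \<bullet> b \<le> u \<bullet> b"
  then have lu: "l \<le> u" by simp
  let ?d = "\<lambda>\<theta>. ennreal (inverse ((cos \<theta>)\<^sup>2)) * indicator {-(pi/2)<..<pi/2} \<theta>"
  have "emeasure (distr (density lborel ?d) borel tan) (box l u)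
      = (\<integral>\<^sup>+ \<theta>. ?d \<theta> * indicator (tan -` box l u) \<theta> \<partial>lborel)"
    using measurable_sets_borel[OF borel_measurable_tan, of "box l u"] by (subst emeasure_distr; (subst emeasure_density)?) auto
  also have "\<dots> = (\<integral>\<^sup>+ \<theta>. ennreal (inverse ((cos \<theta>)\<^sup>2)) * indicator {arctan l..arctan u} \<theta> \<partial>lborel)"
  \<comment> \<open>The closed interval required by the fundamental theorem differs from the
    preimage of the open box by two endpoints, which are null.\<close>
  proof (rule nn_integral_cong_AE, use AE_lborel_singleton[of "arctan l"] AE_lborel_singleton[of "arctan u"] in eventually_elim)
    fix \<theta> assume *: "\<theta> \<noteq> arctan l" "\<theta> \<noteq> arctan u"
    show "?d \<theta> * indicator (tan -` box l u) \<theta> = ennreal (inverse ((cos \<theta>)\<^sup>2)) * indicator {arctan l..arctan u} \<theta>"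
    proof (cases "\<theta> \<in> {-(pi/2)<..<pi/2}")
      case True
      then have "arctan (tan \<theta>) = \<theta>" by (simp add: arctan_tan)
      then have "l < tan \<theta> \<longleftrightarrow> arctan l < \<theta>" "tan \<theta> < u \<longleftrightarrow> \<theta> < arctan u"
        by (metis arctan_less_iff)+
      then show ?thesis using True * by (auto split: split_indicator)
    next
      case False
      then have "\<theta> \<notin> {arctan l..arctan u}" using arctan_lbound[of l] arctan_ubound[of u] by auto
      then show ?thesis using False by auto
    qed
  qed
  also have "\<dots> = ennreal (tan (arctan u) - tan (arctan l))"
  proof (rule nn_integral_FTC_Icc)
    show "arctan l \<le> arctan u" using lu by (simp add: arctan_le_iff)
    fix x assume "x \<in> {arctan l..arctan u}"
    then have "-(pi/2) < x" "x < pi/2" using arctan_lbound[of l] arctan_ubound[of u] by auto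
    then have "cos x \<noteq> 0" using cos_gt_zero_pi by (metis less_irrefl minus_divide_left)
    then show "(tan has_real_derivative inverse ((cos x)\<^sup>2)) (at x)" by (rule DERIV_tan)
  qed auto
  finally show "emeasure (distr (density lborel ?d) borel tan) (box l u) = (\<Prod>b\<in>Basis. (u - l) \<bullet> b)"
    by (simp add: tan_arctan)
qed simp

lemma nn_integral_tan_substitution:
  assumes [measurable]: "f \<in> borel_measurable (borel :: real measure)"
  shows "(\<integral>\<^sup>+ t. f t \<partial>lborel) =
    (\<integral>\<^sup>+ \<theta>. ennreal (inverse ((cos \<theta>)\<^sup>2)) * f (tan \<theta>) * indicator {-(pi/2)<..<pi/2} \<theta> \<partial>lborel)"
proof -
  show ?thesis
    by (subst lborel_eq_distr_tan, subst nn_integral_distr, simp, simp, subst nn_integral_density)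
      (auto simp: ac_simps)
qed

lemma nn_integral_scale_lborel:
  assumes [measurable]: "f \<in> borel_measurable (borel :: real measure)" and "c > 0"
  shows "(\<integral>\<^sup>+ y. f y \<partial>lborel) = (\<integral>\<^sup>+ t. ennreal c * f (c * t) \<partial>lborel)"
  using nn_integral_real_affine[of f c 0] assms by (simp add: nn_integral_cmult)

text \<open>Only one-dimensional substitutions and Tonelli enter. For x > 0 put y = x t (factor x),
  then t = tan \<theta> (factor 1/cos^2), then x = r cos \<theta>, where x dx becomes cos^2 \<theta>
  times r dr and the cosines cancel. The slope t distinguishes rays only on one side of the vertical
  axis, hence the half-plane.\<close>

lemma nn_integral_right_half_plane_polar:
  fixes f :: "real \<times> real \<Rightarrow> ennreal"
  assumes [measurable]: "f \<in> borel_measurable borel"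
  shows "(\<integral>\<^sup>+ p. f p * indicator {0<..} (fst p) \<partial>lborel) =
    (\<integral>\<^sup>+ \<theta>. (\<integral>\<^sup>+ r. ennreal r * f (r * cos \<theta>, r * sin \<theta>) * indicator {0<..} r \<partial>lborel)
        * indicator {-(pi/2)<..<pi/2} \<theta> \<partial>lborel)"
proof -
  have [measurable]: "f \<in> borel_measurable (borel \<Otimes>\<^sub>M borel)"
    by (simp add: borel_prod)
  have "(\<integral>\<^sup>+ p. f p * indicator {0<..} (fst p) \<partial>lborel)
      = (\<integral>\<^sup>+ x. \<integral>\<^sup>+ y. f (x, y) * indicator {0<..} x \<partial>lborel \<partial>lborel)"
    by (simp add: lborel_prod[symmetric] lborel.nn_integral_fst[symmetric] del: nn_integral_indicator_singleton)
  also have "\<dots> = (\<integral>\<^sup>+ x. \<integral>\<^sup>+ t. ennreal x * f (x, x * t) * indicator {0<..} x \<partial>lborel \<partial>lborel)"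
  proof (rule nn_integral_cong)
    fix x :: real
    show "(\<integral>\<^sup>+ y. f (x, y) * indicator {0<..} x \<partial>lborel) = (\<integral>\<^sup>+ t. ennreal x * f (x, x * t) * indicator {0<..} x \<partial>lborel)"
    proof (cases "x > 0")
      case True
      then show ?thesis
        using nn_integral_scale_lborel[of "\<lambda>y. f (x, y)" x] by simp
    qed simp
  qed
  also have "\<dots> = (\<integral>\<^sup>+ t. \<integral>\<^sup>+ x. ennreal x * f (x, x * t) * indicator {0<..} x \<partial>lborel \<partial>lborel)"
    by (rule lborel_pair.Fubini') simp
  also have "\<dots> = (\<integral>\<^sup>+ \<theta>. ennreal (inverse ((cos \<theta>)\<^sup>2)) *
      (\<integral>\<^sup>+ x. ennreal x * f (x, x * tan \<theta>) * indicator {0<..} x \<partial>lborel) * indicator {-(pi/2)<..<pi/2} \<theta> \<partial>lborel)"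
    by (rule nn_integral_tan_substitution) simp
  also have "\<dots> = (\<integral>\<^sup>+ \<theta>. (\<integral>\<^sup>+ r. ennreal r * f (r * cos \<theta>, r * sin \<theta>) * indicator {0<..} r \<partial>lborel)
        * indicator {-(pi/2)<..<pi/2} \<theta> \<partial>lborel)"
  proof (rule nn_integral_cong)
    fix \<theta> :: real
    show "ennreal (inverse ((cos \<theta>)\<^sup>2)) * (\<integral>\<^sup>+ x. ennreal x * f (x, x * tan \<theta>) * indicator {0<..} x \<partial>lborel)
        * indicator {-(pi/2)<..<pi/2} \<theta> =
      (\<integral>\<^sup>+ r. ennreal r * f (r * cos \<theta>, r * sin \<theta>) * indicator {0<..} r \<partial>lborel) * indicator {-(pi/2)<..<pi/2} \<theta>"
    proof (cases "\<theta> \<in> {-(pi/2)<..<pi/2}")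
      case True
      then have c: "cos \<theta> > 0" by (intro cos_gt_zero_pi) auto
      have "(\<integral>\<^sup>+ x. ennreal x * f (x, x * tan \<theta>) * indicator {0<..} x \<partial>lborel)
        = (\<integral>\<^sup>+ r. ennreal (cos \<theta>) * (ennreal (cos \<theta> * r) * f (cos \<theta> * r, cos \<theta> * r * tan \<theta>) * indicator {0<..} (cos \<theta> * r)) \<partial>lborel)"
        by (rule nn_integral_scale_lborel) (use c in auto)
      also have "\<dots> = (\<integral>\<^sup>+ r. ennreal ((cos \<theta>)\<^sup>2) * (ennreal r * f (r * cos \<theta>, r * sin \<theta>) * indicator {0<..} r) \<partial>lborel)"
        using c by (intro nn_integral_cong)
          (auto simp: ennreal_mult' power2_eq_square tan_def ac_simps zero_less_mult_iff split: split_indicator)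
      also have "\<dots> = ennreal ((cos \<theta>)\<^sup>2) * (\<integral>\<^sup>+ r. (ennreal r * f (r * cos \<theta>, r * sin \<theta>) * indicator {0<..} r) \<partial>lborel)"
        by (rule nn_integral_cmult) simp
      finally show ?thesis using c True
        by (simp add: mult.assoc[symmetric] ennreal_mult[symmetric])
    qed simp
  qed
  finally show ?thesis .
qed

section \<open>Moving the window of a periodic integrand\<close>

text \<open>The part [c, c+a] that leaves the window on the left re-enters on the right as
  [c+T, c+a+T], with the same integral by periodicity.\<close>

lemma nn_integral_periodic_shift_aux:
  assumes [measurable]: "g \<in> borel_measurable (borel :: real measure)"
    and per: "\<And>x. g (x + T) = g x" and a: "0 \<le> a" "a \<le> T"
  shows "(\<integral>\<^sup>+ x. g x * indicator {c+a..c+a+T} x \<partial>lborel) = (\<integral>\<^sup>+ x. g x * indicator {c..c+T} x \<partial>lborel)"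
proof -
  have "(\<integral>\<^sup>+ x. g x * indicator {c+a..c+a+T} x \<partial>lborel) =
      (\<integral>\<^sup>+ x. g x * indicator {c+a..c+T} x + g x * indicator {c+T..c+a+T} x \<partial>lborel)"
    by (rule nn_integral_cong_AE, use AE_lborel_singleton[of "c+T"] in eventually_elim)
      (use a in \<open>auto split: split_indicator\<close>)
  also have "\<dots> = (\<integral>\<^sup>+ x. g x * indicator {c+a..c+T} x \<partial>lborel) + (\<integral>\<^sup>+ x. g x * indicator {c+T..c+a+T} x \<partial>lborel)"
    by (rule nn_integral_add) auto
  also have "(\<integral>\<^sup>+ x. g x * indicator {c+T..c+a+T} x \<partial>lborel) = (\<integral>\<^sup>+ x. g x * indicator {c..c+a} x \<partial>lborel)"
    by (subst nn_integral_real_affine[of _ 1 T])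
      (auto intro!: nn_integral_cong simp: per add.commute[of T] split: split_indicator)
  also have "(\<integral>\<^sup>+ x. g x * indicator {c+a..c+T} x \<partial>lborel) + (\<integral>\<^sup>+ x. g x * indicator {c..c+a} x \<partial>lborel)
    = (\<integral>\<^sup>+ x. g x * indicator {c+a..c+T} x + g x * indicator {c..c+a} x \<partial>lborel)"
    by (rule nn_integral_add[symmetric]) auto
  also have "\<dots> = (\<integral>\<^sup>+ x. g x * indicator {c..c+T} x \<partial>lborel)"
    by (rule nn_integral_cong_AE, use AE_lborel_singleton[of "c+a"] in eventually_elim)
      (use a in \<open>auto split: split_indicator\<close>)
  finally show ?thesis .
qed

lemma nn_integral_periodic_shift:
  assumes [measurable]: "g \<in> borel_measurable (borel :: real measure)"
    and per: "\<And>x. g (x + T) = g x" and T: "T > 0"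
  shows "(\<integral>\<^sup>+ x. g x * indicator {b..b+T} x \<partial>lborel) = (\<integral>\<^sup>+ x. g x * indicator {c..c+T} x \<partial>lborel)"
proof -
  have *: "(\<integral>\<^sup>+ x. g x * indicator {c + real n * T..c + real n * T + T} x \<partial>lborel) = (\<integral>\<^sup>+ x. g x * indicator {c..c+T} x \<partial>lborel)" for n c
  proof (induction n)
    case (Suc n)
    then show ?case using nn_integral_periodic_shift_aux[OF assms(1,2), of T "c + real n * T"] T
      by (simp add: algebra_simps)
  qed simp
  \<comment> \<open>The auxiliary lemma moves a window to the right by at most T. Pushing b past c
    by n full periods makes the distance to c positive; its integer part in periods is then a
    natural number m, and an offset in [0, T) remains.\<close>
  obtain n where n: "real n * T > c - b" using reals_Archimedean3[OF T] by blast
  obtain m where m: "real m * T \<le> b + real n * T - c" "b + real n * T - c < real (Suc m) * T"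
    using floor_divide_lower[OF T, of "b + real n * T - c"] floor_divide_upper[OF T, of "b + real n * T - c"]
      n T by (intro that[of "nat \<lfloor>(b + real n * T - c)/T\<rfloor>"]) (auto simp: of_nat_nat add.commute)
  have "(\<integral>\<^sup>+ x. g x * indicator {b..b+T} x \<partial>lborel) = (\<integral>\<^sup>+ x. g x * indicator {b + real n * T..b + real n * T + T} x \<partial>lborel)"
    using * by simp
  also have "\<dots> = (\<integral>\<^sup>+ x. g x * indicator {c + real m * T..c + real m * T + T} x \<partial>lborel)"
    using nn_integral_periodic_shift_aux[OF assms(1,2), of "b + real n * T - c - real m * T" "c + real m * T"] m
    by (simp add: algebra_simps)
  finally show ?thesis using * by simp
qed

text \<open>The left half-plane is the image of the right one under p -> -p, which shifts the angle
  by pi; the axis between them is null. The start a of the window is free, so that angles can be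
  measured from any direction.\<close>

theorem nn_integral_polar:
  fixes f :: "real \<times> real \<Rightarrow> ennreal"
  assumes [measurable]: "f \<in> borel_measurable borel"
  shows "(\<integral>\<^sup>+ p. f p \<partial>lborel) =
    (\<integral>\<^sup>+ \<theta>. (\<integral>\<^sup>+ r. ennreal r * f (r * cos \<theta>, r * sin \<theta>) * indicator {0<..} r \<partial>lborel)
        * indicator {a..a + 2*pi} \<theta> \<partial>lborel)"
proof -
  have [measurable]: "f \<in> borel_measurable (borel \<Otimes>\<^sub>M borel)"
    by (simp add: borel_prod)
  define G where "G \<theta> = (\<integral>\<^sup>+ r. ennreal r * f (r * cos \<theta>, r * sin \<theta>) * indicator {0<..} r \<partial>lborel)" for \<theta>
  have mG[measurable]: "G \<in> borel_measurable borel" unfolding G_def by measurable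
  have "(\<lambda>p. f (- p)) \<in> borel_measurable borel"
    by measurable
  then have [measurable]: "(\<lambda>p. f (- p)) \<in> borel_measurable (borel \<Otimes>\<^sub>M borel)"
    by (simp add: borel_prod)
  have ax: "AE p :: real \<times> real in lborel. fst p \<noteq> 0"
  proof -
    have "AE p in lborel \<Otimes>\<^sub>M (lborel::real measure). fst p \<noteq> (0::real)"
      proof (rule lborel_pair.AE_pair_measure)
      show "AE x in lborel. AE y in (lborel::real measure). fst (x, y) \<noteq> (0::real)"
        using AE_lborel_singleton[of "0::real"] by eventually_elim simp
    qed measurable
    then show ?thesis unfolding lborel_prod .
  qed
  have "(\<integral>\<^sup>+ p. f p \<partial>lborel) = (\<integral>\<^sup>+ p. f p * indicator {0<..} (fst p) + f p * indicator {..<0} (fst p) \<partial>lborel)"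
    by (rule nn_integral_cong_AE, use ax in eventually_elim) (auto split: split_indicator)
  also have "\<dots> = (\<integral>\<^sup>+ p. f p * indicator {0<..} (fst p) \<partial>lborel) + (\<integral>\<^sup>+ p. f p * indicator {..<0} (fst p) \<partial>lborel)"
    by (rule nn_integral_add) (auto simp: borel_prod[symmetric])
  also have "(\<integral>\<^sup>+ p. f p * indicator {..<0} (fst p) \<partial>lborel) = (\<integral>\<^sup>+ p. f (- p) * indicator {0<..} (fst p) \<partial>lborel)"
  proof -
    have "(\<integral>\<^sup>+ p. f p * indicator {..<0} (fst p) \<partial>lborel) = (\<integral>\<^sup>+ x. \<integral>\<^sup>+ y. f (x, y) * indicator {..<0} x \<partial>lborel \<partial>lborel)"
      by (simp add: lborel_prod[symmetric] lborel.nn_integral_fst[symmetric])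
    also have "\<dots> = (\<integral>\<^sup>+ x. \<integral>\<^sup>+ y. f (-x, y) * indicator {..<0} (-x) \<partial>lborel \<partial>lborel)"
      by (subst nn_integral_real_affine[of _ "-1" 0]) simp_all
    also have "\<dots> = (\<integral>\<^sup>+ x. \<integral>\<^sup>+ y. f (-x, -y) * indicator {..<0} (-x) \<partial>lborel \<partial>lborel)"
      by (rule nn_integral_cong, subst nn_integral_real_affine[of _ "-1" 0]) simp_all
    also have "\<dots> = (\<integral>\<^sup>+ x. \<integral>\<^sup>+ y. f (- (x, y)) * indicator {0<..} x \<partial>lborel \<partial>lborel)"
      by (simp add: indicator_def)
    also have "\<dots> = (\<integral>\<^sup>+ p. f (- p) * indicator {0<..} (fst p) \<partial>lborel)"
      by (simp add: lborel_prod[symmetric] lborel.nn_integral_fst[symmetric])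
    finally show ?thesis .
  qed
  also have "\<dots> = (\<integral>\<^sup>+ \<theta>. G (\<theta> + pi) * indicator {-(pi/2)<..<pi/2} \<theta> \<partial>lborel)"
    by (subst nn_integral_right_half_plane_polar) (simp_all add: G_def)
  also have "\<dots> = (\<integral>\<^sup>+ \<theta>. G \<theta> * indicator {pi/2<..<3*pi/2} \<theta> \<partial>lborel)"
    by (subst (2) nn_integral_real_affine[of _ 1 pi])
      (auto intro!: nn_integral_cong simp: add.commute[of pi] split: split_indicator)
  also have "(\<integral>\<^sup>+ p. f p * indicator {0<..} (fst p) \<partial>lborel) = (\<integral>\<^sup>+ \<theta>. G \<theta> * indicator {-(pi/2)<..<pi/2} \<theta> \<partial>lborel)"
    by (subst nn_integral_right_half_plane_polar) (simp_all add: G_def)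
  also have "(\<integral>\<^sup>+ \<theta>. G \<theta> * indicator {-(pi/2)<..<pi/2} \<theta> \<partial>lborel) + (\<integral>\<^sup>+ \<theta>. G \<theta> * indicator {pi/2<..<3*pi/2} \<theta> \<partial>lborel)
    = (\<integral>\<^sup>+ \<theta>. G \<theta> * indicator {-(pi/2)<..<pi/2} \<theta> + G \<theta> * indicator {pi/2<..<3*pi/2} \<theta> \<partial>lborel)"
    by (rule nn_integral_add[symmetric]) auto
  also have "\<dots> = (\<integral>\<^sup>+ \<theta>. G \<theta> * indicator {-(pi/2)..-(pi/2) + 2*pi} \<theta> \<partial>lborel)"
    by (rule nn_integral_cong_AE, use AE_lborel_singleton[of "pi/2"] AE_lborel_singleton[of "-(pi/2)"]
        AE_lborel_singleton[of "3*pi/2"] in eventually_elim)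
      (auto split: split_indicator)
  also have "\<dots> = (\<integral>\<^sup>+ \<theta>. G \<theta> * indicator {a..a + 2*pi} \<theta> \<partial>lborel)"
    by (rule nn_integral_periodic_shift) (auto simp: G_def)
  finally show ?thesis unfolding G_def .
qed

section \<open>Laplace transforms and Gamma distributions\<close>

text \<open>Rectangles are stable under intersection and generate the product sigma-algebra; as
  \<open>M\<close> is finite, the constant sequence of whole spaces serves as the exhausting
  sequence.\<close>

lemma measure_eqI_rectangles:
  assumes sets: "sets M = sets (S \<Otimes>\<^sub>M T)" "sets M' = sets (S \<Otimes>\<^sub>M T)"
    and fin: "finite_measure M"
    and eq: "\<And>A B. A \<in> sets S \<Longrightarrow> B \<in> sets T \<Longrightarrow> emeasure M (A \<times> B) = emeasure M' (A \<times> B)"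
  shows "M = M'"
proof (rule measure_eqI_generator_eq[OF Int_stable_pair_measure_generator[of S T] pair_measure_closed])
  show "sets M = sigma_sets (space S \<times> space T) {a \<times> b |a b. a \<in> sets S \<and> b \<in> sets T}"
    "sets M' = sigma_sets (space S \<times> space T) {a \<times> b |a b. a \<in> sets S \<and> b \<in> sets T}"
    using sets by (simp_all add: sets_pair_measure)
  show "range (\<lambda>i::nat. space S \<times> space T) \<subseteq> {a \<times> b |a b. a \<in> sets S \<and> b \<in> sets T}"
    by auto
  show "emeasure M (space S \<times> space T) \<noteq> \<infinity>" for i :: nat
    using finite_measure.emeasure_finite[OF fin] by simp
qed (use eq in auto)

section \<open>Differentiating a Laplace transform under the integral sign\<close>

text \<open>(s x)^n / n! is one term of the series of exp (s x), whose terms are all nonnegative.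
  The bound is constant in x, hence integrable against any finite measure.\<close>

lemma power_times_exp_le:
  fixes s x :: real
  assumes "s > 0" "x \<ge> 0"
  shows "x ^ n * exp (- (s * x)) \<le> fact n / s ^ n"
proof -
  have "(\<Sum>k\<in>{n}. (s * x) ^ k /\<^sub>R fact k) \<le> (\<Sum>k. (s * x) ^ k /\<^sub>R fact k)"
    using assms by (intro sum_le_suminf summable_exp_generic) auto
  then have "(s * x) ^ n / fact n \<le> exp (s * x)"
    by (simp add: exp_def divide_inverse mult.commute)
  then show ?thesis using assms by (simp add: exp_minus field_simps power_mult_distrib)
qed

text \<open>From 1 - exp (- v) \<le> v with v = |t - s| x. The common lower rate u makes the bound
  uniform over all t near s.\<close>

lemma exp_diff_le:
  fixes u s t x :: real
  assumes "u \<le> s" "u \<le> t" "x \<ge> 0"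
  shows "\<bar>exp (- (t * x)) - exp (- (s * x))\<bar> \<le> \<bar>t - s\<bar> * (x * exp (- (u * x)))"
proof -
  have *: "\<bar>exp (- (t * x)) - exp (- (s * x))\<bar> \<le> \<bar>t - s\<bar> * (x * exp (- (u * x)))"
    if "s \<le> t" "u \<le> s" for s t
  proof -
    have "exp (- (s * x)) - exp (- (t * x)) = exp (- (s * x)) * (1 - exp (- ((t - s) * x)))"
      by (simp add: algebra_simps exp_add[symmetric])
    also have "\<dots> \<le> exp (- (u * x)) * ((t - s) * x)"
    proof (rule mult_mono)
      show "exp (- (s * x)) \<le> exp (- (u * x))" using that assms by (simp add: mult_right_mono)
      show "1 - exp (- ((t - s) * x)) \<le> (t - s) * x" using exp_ge_add_one_self[of "- ((t - s) * x)"] by simp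
    qed (use that assms in auto)
    moreover have "exp (- (t * x)) \<le> exp (- (s * x))" using that assms by (simp add: mult_right_mono)
    ultimately show ?thesis using that by (simp add: mult_ac abs_if)
  qed
  show ?thesis
    using *[of s t] *[of t s] assms by (cases "s \<le> t") (simp_all add: abs_minus_commute)
qed

context
  fixes J :: "real measure"
  assumes J: "finite_measure J" "sets J = sets borel" "AE x in J. 0 \<le> x"
begin

lemma integrable_exp_moment:
  assumes "s > 0"
  shows "integrable J (\<lambda>x. (- x) ^ n * exp (- (s * x)))"
proof (rule finite_measure.integrable_const_bound[OF J(1), where B = "fact n / s ^ n"])
  show "AE x in J. norm ((- x) ^ n * exp (- (s * x))) \<le> fact n / s ^ n"
    using J(3) by eventually_elim
      (use power_times_exp_le[OF assms] in \<open>auto simp: abs_mult power_abs\<close>)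
qed (simp add: measurable_cong_sets[OF J(2) refl])

lemma has_derivative_exp_moment:
  assumes s: "s > 0"
  shows "((\<lambda>s. \<integral>x. (- x) ^ n * exp (- (s * x)) \<partial>J) has_real_derivative
    (\<integral>x. (- x) ^ Suc n * exp (- (s * x)) \<partial>J)) (at s)"
proof -
  note [measurable_cong] = J(2)
  \<comment> \<open>Rates above s/2 bound every difference quotient by x^(n+1) exp (- (s/2) x),
    hence by the constant (n+1)! / (s/2)^(n+1), and dominated convergence applies along sequences.
    As \<open>S\<close> is open, the limit within it is the full limit.\<close>
  define S where "S = {s/2<..}"
  let ?f = "\<lambda>s. \<integral>x. (- x) ^ n * exp (- (s * x)) \<partial>J"
  have "((\<lambda>t. (?f t - ?f s) / (t - s)) \<longlongrightarrow> (\<integral>x. (- x) ^ Suc n * exp (- (s * x)) \<partial>J)) (at s within S)"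
    unfolding tendsto_at_iff_sequentially comp_def
  proof (intro allI impI)
    fix X :: "nat \<Rightarrow> real" assume X: "\<forall>i. X i \<in> S - {s}" "X \<longlonglongrightarrow> s"
    let ?q = "\<lambda>i x. (- x) ^ n * ((exp (- (X i * x)) - exp (- (s * x))) / (X i - s))"
    have Xi: "X i > s/2" "X i > 0" "X i \<noteq> s" for i
      using X(1) s by (auto simp: S_def dest: spec[of _ i])
    have "(\<lambda>i. \<integral>x. ?q i x \<partial>J) \<longlonglongrightarrow> (\<integral>x. (- x) ^ Suc n * exp (- (s * x)) \<partial>J)"
    proof (rule integral_dominated_convergence[where w = "\<lambda>_. fact (Suc n) / (s/2) ^ Suc n"])
      show "AE x in J. (\<lambda>i. ?q i x) \<longlonglongrightarrow> (- x) ^ Suc n * exp (- (s * x))"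
      proof (rule AE_I2)
        fix x
        have "((\<lambda>s. exp (- (s * x))) has_real_derivative (- x * exp (- (s * x)))) (at s)"
          by (auto intro!: derivative_eq_intros)
        then have "((\<lambda>t. (exp (- (t * x)) - exp (- (s * x))) / (t - s)) \<longlongrightarrow> - x * exp (- (s * x))) (at s)"
          by (simp add: has_field_derivative_iff)
        then have "(\<lambda>i. (exp (- (X i * x)) - exp (- (s * x))) / (X i - s)) \<longlonglongrightarrow> - x * exp (- (s * x))"
          using X Xi(3) unfolding tendsto_at_iff_sequentially comp_def by auto
        then show "(\<lambda>i. ?q i x) \<longlonglongrightarrow> (- x) ^ Suc n * exp (- (s * x))"
          by (rule tendsto_eq_rhs[OF tendsto_mult_left]) simp
      qed
      show "AE x in J. norm (?q i x) \<le> fact (Suc n) / (s/2) ^ Suc n" for i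
        using J(3)
      proof eventually_elim
        fix x :: real assume x: "0 \<le> x"
        have q: "\<bar>exp (- (X i * x)) - exp (- (s * x))\<bar> / \<bar>X i - s\<bar> \<le> x * exp (- (s/2 * x))"
          using exp_diff_le[of "s/2" s "X i" x] Xi[of i] s x by (simp add: field_simps)
        have "norm (?q i x) \<le> x ^ n * (x * exp (- (s/2 * x)))"
          using x mult_left_mono[OF q, of "x ^ n"] by (simp add: abs_mult power_abs)
        also have "\<dots> \<le> fact (Suc n) / (s/2) ^ Suc n"
          using power_times_exp_le[of "s/2" x "Suc n"] s x by (simp add: mult_ac)
        finally show "norm (?q i x) \<le> fact (Suc n) / (s/2) ^ Suc n" .
      qed
      show "integrable J (\<lambda>_. fact (Suc n) / (s/2) ^ Suc n)"
        using J(1) by (simp add: finite_measure.integrable_const)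
    qed measurable
    moreover have "(?f (X i) - ?f s) / (X i - s) = (\<integral>x. ?q i x \<partial>J)" for i
    proof -
      have "?f (X i) - ?f s = (\<integral>x. (- x) ^ n * exp (- (X i * x)) - (- x) ^ n * exp (- (s * x)) \<partial>J)"
        using integrable_exp_moment Xi s by (intro Bochner_Integration.integral_diff[symmetric]) auto
      also have "\<dots> = (\<integral>x. (X i - s) * ?q i x \<partial>J)"
        using Xi[of i] by (intro Bochner_Integration.integral_cong) (auto simp: field_simps)
      finally show ?thesis using Xi[of i] by simp
    qed
    ultimately show "(\<lambda>i. (?f (X i) - ?f s) / (X i - s)) \<longlonglongrightarrow> (\<integral>x. (- x) ^ Suc n * exp (- (s * x)) \<partial>J)"
      by presburger
  qed
  moreover have "at s within S = at s"
    using s by (intro at_within_open) (auto simp: S_def)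
  ultimately show ?thesis by (simp add: has_field_derivative_iff)
qed

text \<open>The positive axis is open, so agreement of \<open>F\<close> with the transform there
  gives agreement near each s > 0, and that is what every further \<open>deriv\<close>
  requires.\<close>

lemma higher_deriv_laplace_transform:
  assumes F: "\<And>s. s > 0 \<Longrightarrow> F s = (\<integral>x. exp (- (s * x)) \<partial>J)" and "s > 0"
  shows "(deriv ^^ n) F s = (\<integral>x. (- x) ^ n * exp (- (s * x)) \<partial>J)"
  using \<open>s > 0\<close>
proof (induction n arbitrary: s)
  case (Suc n)
  have "eventually (\<lambda>t. t > 0) (nhds s)"
    using eventually_nhds_in_open[of "{0<..}" s] Suc.prems by simp
  then have "eventually (\<lambda>t. (deriv ^^ n) F t = (\<integral>x. (- x) ^ n * exp (- (t * x)) \<partial>J)) (nhds s)"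
    by eventually_elim (rule Suc.IH)
  then have "deriv ((deriv ^^ n) F) s = deriv (\<lambda>t. \<integral>x. (- x) ^ n * exp (- (t * x)) \<partial>J) s"
    by (rule deriv_cong_ev) simp
  also have "\<dots> = (\<integral>x. (- x) ^ Suc n * exp (- (s * x)) \<partial>J)"
    by (rule DERIV_imp_deriv[OF has_derivative_exp_moment[OF Suc.prems]])
  finally show ?case by simp
qed (simp add: F)

text \<open>Expanding \<open>(i + v)^n\<close> turns the mixture of Poisson tails into derivatives of the Laplace transform.\<close>
lemma poisson_tail_laplace_transform:
  fixes v :: real
  assumes F: "\<And>s. s > 0 \<Longrightarrow> F s = (\<integral>x. exp (- (s * x)) \<partial>J)" and s: "s > 0"
  shows "(\<integral>i. (\<Sum>n<m. (s * (i + v)) ^ n / fact n * exp (- (s * (i + v)))) \<partial>J) =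
    (\<Sum>n<m. (- s) ^ n / fact n * exp (- s * v) * (\<Sum>j = 0..n. real (n choose j) * (- v) ^ (n - j) * (deriv ^^ j) F s))"
    and "integrable J (\<lambda>i. \<Sum>n<m. (s * (i + v)) ^ n / fact n * exp (- (s * (i + v))))"
proof -
  have int: "integrable J (\<lambda>x. (- x) ^ n * exp (- (s * x)))" for n
    using s by (rule integrable_exp_moment)
  have eq: "(s * (i + v)) ^ n / fact n * exp (- (s * (i + v))) =
    (- s) ^ n / fact n * exp (- s * v) * (\<Sum>j = 0..n. real (n choose j) * (- v) ^ (n - j) * ((- i) ^ j * exp (- (s * i))))" for i n
  proof -
    \<comment> \<open>The signs are absorbed into the n-th powers so that the expansion produces (-
      i)^j, the integrand of the j-th derivative.\<close>
    have "(s * (i + v)) ^ n = (- s) ^ n * (- i + - v) ^ n"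
      by (simp add: power_mult_distrib[symmetric] algebra_simps)
    also have "(- i + - v) ^ n = (\<Sum>j = 0..n. real (n choose j) * (- i) ^ j * (- v) ^ (n - j))"
      by (subst binomial_ring) (simp add: atMost_atLeast0)
    finally show ?thesis
      by (simp add: sum_distrib_left sum_divide_distrib algebra_simps exp_diff exp_minus divide_simps)

  qed
  have i2: "integrable J (\<lambda>i. (- s) ^ n / fact n * exp (- s * v) * (\<Sum>j = 0..n. real (n choose j) * (- v) ^ (n - j) * ((- i) ^ j * exp (- (s * i)))))" for n
    using int by (intro integrable_mult_right Bochner_Integration.integrable_sum) auto
  show "integrable J (\<lambda>i. \<Sum>n<m. (s * (i + v)) ^ n / fact n * exp (- (s * (i + v))))"
    unfolding eq using i2 by (intro Bochner_Integration.integrable_sum) auto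
  show "(\<integral>i. (\<Sum>n<m. (s * (i + v)) ^ n / fact n * exp (- (s * (i + v)))) \<partial>J) =
    (\<Sum>n<m. (- s) ^ n / fact n * exp (- s * v) * (\<Sum>j = 0..n. real (n choose j) * (- v) ^ (n - j) * (deriv ^^ j) F s))"
    unfolding eq using int i2
    by (simp add: Bochner_Integration.integral_sum higher_deriv_laplace_transform[OF F s])
qed

end

section \<open>Tail and Laplace transform of the Gamma distribution\<close>

text \<open>\<open>erlang_CDF\<close> is one minus a Poisson sum, which the complement recovers. The
  parameter k is the shape minus one, so there are k + 1 terms.\<close>

lemma emeasure_erlang_greaterThan:
  assumes [arith]: "0 < l" "0 \<le> t"
  shows "emeasure (density lborel (\<lambda>x. ennreal (erlang_density k l x))) {t<..} =
    ennreal (\<Sum>n<Suc k. (l * t) ^ n / fact n * exp (- (l * t)))"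
proof -
  interpret prob_space "density lborel (\<lambda>x. ennreal (erlang_density k l x))"
    by (rule prob_space_erlang_density) simp
  have "emeasure (density lborel (\<lambda>x. ennreal (erlang_density k l x))) {t<..} = 1 - ennreal (erlang_CDF k l t)"
    using emeasure_compl[of "{..t}" "density lborel (\<lambda>x. ennreal (erlang_density k l x))"]
      emeasure_erlang_density[of l k t] emeasure_space_1
    by (simp add: Compl_eq_Diff_UNIV[symmetric])
  also have "\<dots> = ennreal (\<Sum>n<Suc k. (l * t) ^ n / fact n * exp (- (l * t)))"
    using erlang_CDF_nonneg[of l k t] unfolding ennreal_1[symmetric]
    by (subst ennreal_minus) (simp_all add: erlang_CDF_def lessThan_Suc_atMost)
  finally show ?thesis .
qed

text \<open>Exponential tilting: the factor exp (- c x) turns the density of rate l into that of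
  rate l + c, up to the constant on the right, and a density has mass 1.\<close>

lemma nn_integral_exp_erlang:
  assumes [arith]: "0 < l" "0 \<le> c"
  shows "(\<integral>\<^sup>+ x. ennreal (exp (- (c * x))) \<partial>density lborel (\<lambda>x. ennreal (erlang_density k l x))) =
    ennreal ((l / (l + c)) ^ Suc k)"
proof -
  have "(\<integral>\<^sup>+ x. ennreal (exp (- (c * x))) \<partial>density lborel (\<lambda>x. ennreal (erlang_density k l x)))
    = (\<integral>\<^sup>+ x. ennreal (erlang_density k l x) * ennreal (exp (- (c * x))) \<partial>lborel)"
    by (rule nn_integral_density) auto
  also have "\<dots> = (\<integral>\<^sup>+ x. ennreal ((l / (l + c)) ^ Suc k) * ennreal (erlang_density k (l + c) x) \<partial>lborel)"
  proof (intro nn_integral_cong)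
    fix x
    have "erlang_density k l x * exp (- (c * x)) = (l / (l + c)) ^ Suc k * erlang_density k (l + c) x"
      proof -
      have "(l / (l + c)) ^ Suc k * (l + c) ^ Suc k = l ^ Suc k"
        by (subst power_mult_distrib[symmetric]) simp
      moreover have "exp (- ((l + c) * x)) = exp (- (l * x)) * exp (- (c * x))"
        by (simp add: exp_add[symmetric] algebra_simps)
      moreover have "- (l + c) * x = - ((l + c) * x)" "- l * x = - (l * x)" by (simp_all add: algebra_simps)
      ultimately show ?thesis
        unfolding erlang_density_def by (simp only: if_distrib) (simp add: mult_ac)
    qed
    then show "ennreal (erlang_density k l x) * ennreal (exp (- (c * x))) = ennreal ((l / (l + c)) ^ Suc k) * ennreal (erlang_density k (l + c) x)"
      by (simp add: ennreal_mult[symmetric])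
  qed
  also have "\<dots> = ennreal ((l / (l + c)) ^ Suc k) * (\<integral>\<^sup>+ x. ennreal (erlang_density k (l + c) x) \<partial>lborel)"
    by (rule nn_integral_cmult) simp
  also have "(\<integral>\<^sup>+ x. ennreal (erlang_density k (l + c) x) \<partial>lborel) = 1"
    using nn_integral_erlang_ith_moment[of "l + c" k 0] by simp
  finally show ?thesis by simp
qed

section \<open>Joint law of positions, link states and gains\<close>

lemma abs_dist_eq: "abs_dist N x = sqrt ((dist x (stadium_center N))\<^sup>2 + (height N)\<^sup>2)"
  by (simp add: abs_dist_def dist_Pair_Pair dist_real_def)

lemma height_le_abs_dist: "height N \<le> abs_dist N x"
  unfolding abs_dist_eq by (rule real_le_rsqrt) simp

lemma space_gain_distribution [simp]: "space (gain_distribution N k) = UNIV"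
  and sets_gain_distribution [simp, measurable_cong]: "sets (gain_distribution N k) = sets borel"
  by (simp_all add: gain_distribution_def)

text \<open>\<open>density M (indicator Q)\<close> is the restriction of \<open>M\<close> to
  \<open>Q\<close>. It is left unnormalised, so that link states of probability zero need no
  separate treatment.\<close>

lemma emeasure_distr_density_indicator:
  assumes [measurable]: "Q \<in> sets M" "Y \<in> M \<rightarrow>\<^sub>M P" "E \<in> sets P"
  shows "emeasure (distr (density M (indicator Q)) P Y) E = emeasure M {w \<in> space M. w \<in> Q \<and> Y w \<in> E}"
proof -
  have "emeasure (distr (density M (indicator Q)) P Y) E = emeasure (density M (indicator Q)) (Y -` E \<inter> space M)"
    by (subst emeasure_distr) auto
  also have "\<dots> = emeasure M (Q \<inter> (Y -` E \<inter> space M))"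
    by (rule emeasure_restricted) auto
  also have "Q \<inter> (Y -` E \<inter> space M) = {w \<in> space M. w \<in> Q \<and> Y w \<in> E}" by auto
  finally show ?thesis .
qed

text \<open>For a position law \<open>\<mu>\<close>, the joint law of position and gain on the event
  that the link is in state k: a sub-probability measure whose total mass is the probability of that
  state.\<close>

definition link_law :: "uplink \<Rightarrow> (real \<times> real) measure \<Rightarrow> link_state \<Rightarrow> ((real \<times> real) \<times> real) measure" where
  "link_law N \<mu> k = density \<mu> (\<lambda>x. ennreal (link_prob N k (abs_dist N x))) \<Otimes>\<^sub>M gain_distribution N k"

lemma sets_link_law [simp, measurable_cong]:
  "sets \<mu> = sets borel \<Longrightarrow> sets (link_law N \<mu> k) = sets (borel \<Otimes>\<^sub>M borel)"
  unfolding link_law_def by (intro sets_pair_measure_cong) simp_all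

context uplink_model
begin

lemma prob_space_gain_distribution: "prob_space (gain_distribution N k)"
  unfolding gain_distribution_def using m_pos[of k] by (intro prob_space_erlang_density) simp

text \<open>\<open>p_L_measurable\<close> covers only arguments from the altitude upwards; a slant
  distance never falls below the altitude, so the composition is measurable on the whole
  plane.\<close>

lemma link_prob_measurable [measurable]:
  "(\<lambda>x. link_prob N k (abs_dist N x)) \<in> borel_measurable borel"
proof -
  have "abs_dist N \<in> borel \<rightarrow>\<^sub>M restrict_space borel {height N..}"
    by (rule measurable_restrict_space2) (auto simp: height_le_abs_dist abs_dist_eq[abs_def])
  then have "(\<lambda>x. p\<^sub>L N (abs_dist N x)) \<in> borel_measurable borel"
    using p_L_measurable by (rule measurable_compose)
  then show ?thesis by (cases k) (simp_all add: link_prob_def)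
qed

lemma link_prob_nonneg: "z \<ge> height N \<Longrightarrow> 0 \<le> link_prob N k z"
  and link_prob_le_1: "z \<ge> height N \<Longrightarrow> link_prob N k z \<le> 1"
  using p_L_range[of z] by (cases k; simp add: link_prob_def)+

lemma link_prob_sum: "link_prob N LOS z + link_prob N NLOS z = 1"
  by (simp add: link_prob_def)

definition "\<mu>\<^sub>A = distr Pr borel X\<^sub>A"
definition "\<mu>\<^sub>T = distr Pr borel X\<^sub>T"

lemma sets_mu [simp, measurable_cong]: "sets \<mu>\<^sub>A = sets borel" "sets \<mu>\<^sub>T = sets borel"
  by (simp_all add: \<mu>\<^sub>A_def \<mu>\<^sub>T_def)

lemma prob_space_mu: "prob_space \<mu>\<^sub>A" "prob_space \<mu>\<^sub>T"
  unfolding \<mu>\<^sub>A_def \<mu>\<^sub>T_def using X_measurable by (auto intro: prob_space_distr)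

lemma emeasure_link_law_rectangle:
  assumes "sets \<mu> = sets borel" "prob_space \<mu>" "A \<in> sets borel" "U \<in> sets borel"
  shows "emeasure (link_law N \<mu> k) (A \<times> U) =
    ennreal ((\<integral>x. indicator A x * link_prob N k (abs_dist N x) \<partial>\<mu>) * measure (gain_distribution N k) U)"
proof -
  interpret \<mu>: prob_space \<mu> by fact
  interpret g: prob_space "gain_distribution N k" by (rule prob_space_gain_distribution)
  note [measurable_cong] = assms(1)
  note [measurable] = assms(3,4)
  have "emeasure (link_law N \<mu> k) (A \<times> U) =
      emeasure (density \<mu> (\<lambda>x. ennreal (link_prob N k (abs_dist N x)))) A * emeasure (gain_distribution N k) U"
    unfolding link_law_def using assms by (intro g.emeasure_pair_measure_Times) auto
  also have "emeasure (density \<mu> (\<lambda>x. ennreal (link_prob N k (abs_dist N x)))) A =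
      (\<integral>\<^sup>+ x. ennreal (indicator A x * link_prob N k (abs_dist N x)) \<partial>\<mu>)"
    using assms by (subst emeasure_density) (auto intro!: nn_integral_cong split: split_indicator)
  also have "\<dots> = ennreal (\<integral>x. indicator A x * link_prob N k (abs_dist N x) \<partial>\<mu>)"
    by (intro nn_integral_eq_integral \<mu>.integrable_const_bound[where B = 1])
      (auto simp: link_prob_nonneg link_prob_le_1 height_le_abs_dist split: split_indicator)
  finally show ?thesis
    by (simp add: g.emeasure_eq_measure ennreal_mult'' )
qed

section \<open>The tower property on rectangles\<close>

text \<open>The event on the positions belongs to the conditioning sigma-algebra, so under the
  integral the state event may be replaced by its conditional probability. The integrand is then a
  function of one position times a function of the other, and \<open>positions_indep\<close> splits
  it.\<close>

lemma prob_positions_states: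
  assumes [measurable]: "A \<in> sets borel" "B \<in> sets borel"
  shows "prob {w \<in> space Pr. X\<^sub>A w \<in> A \<and> X\<^sub>T w \<in> B \<and> K\<^sub>A w = k \<and> K\<^sub>T w = l} =
    (\<integral>x. indicator A x * link_prob N k (abs_dist N x) \<partial>\<mu>\<^sub>A) *
    (\<integral>x. indicator B x * link_prob N l (abs_dist N x) \<partial>\<mu>\<^sub>T)"
proof -
  note [measurable] = X_measurable K_measurable
  define F where "F = vimage_algebra (space Pr) (\<lambda>w. (X\<^sub>A w, X\<^sub>T w)) (borel \<Otimes>\<^sub>M borel)"
  interpret F: finite_measure_subalgebra Pr F
  proof
    show "subalgebra Pr F"
      unfolding subalgebra_def F_def
      by (auto simp: sets_vimage_algebra2 space_pair_measure intro!: measurable_sets[of _ Pr "borel \<Otimes>\<^sub>M borel"])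
  qed
  define E where "E = {w \<in> space Pr. X\<^sub>A w \<in> A \<and> X\<^sub>T w \<in> B}"
  define S where "S = {w \<in> space Pr. K\<^sub>A w = k \<and> K\<^sub>T w = l}"
  have E: "E \<in> sets F"
  proof -
    have "E = (\<lambda>w. (X\<^sub>A w, X\<^sub>T w)) -` (A \<times> B) \<inter> space Pr" by (auto simp: E_def)
    moreover have "A \<times> B \<in> sets (borel \<Otimes>\<^sub>M borel)" by simp
    ultimately show ?thesis unfolding F_def by (auto intro: in_vimage_algebra)
  qed
  have [measurable]: "E \<in> events" "S \<in> events" unfolding E_def S_def by measurable
  define a where "a x = indicator A x * link_prob N k (abs_dist N x)" for x
  define b where "b x = indicator B x * link_prob N l (abs_dist N x)" for x
  have [measurable]: "a \<in> borel_measurable borel" "b \<in> borel_measurable borel"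
    unfolding a_def[abs_def] b_def[abs_def] by measurable
  have ab: "norm (a x) \<le> 1" "norm (b x) \<le> 1" for x
    by (auto simp: a_def b_def link_prob_nonneg link_prob_le_1 height_le_abs_dist split: split_indicator)
  have "prob {w \<in> space Pr. X\<^sub>A w \<in> A \<and> X\<^sub>T w \<in> B \<and> K\<^sub>A w = k \<and> K\<^sub>T w = l} = prob (E \<inter> S)"
    by (rule arg_cong[where f = prob]) (auto simp: E_def S_def)
  also have "\<dots> = (\<integral>w\<in>E. indicator S w \<partial>Pr)"
    unfolding set_lebesgue_integral_def by (simp add: indicator_inter_arith[symmetric] mult.commute)
  also have "\<dots> = (\<integral>w\<in>E. real_cond_exp Pr F (indicator S) w \<partial>Pr)"
    using E by (intro F.real_cond_exp_intA) (auto simp: emeasure_eq_measure)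
  also have "\<dots> = (\<integral>w. a (X\<^sub>A w) * b (X\<^sub>T w) \<partial>Pr)"
    unfolding set_lebesgue_integral_def
  proof (rule integral_cong_AE)
    show "AE w in Pr. indicator E w *\<^sub>R real_cond_exp Pr F (indicator S) w = a (X\<^sub>A w) * b (X\<^sub>T w)"
      using link_states_given_positions[of k l, folded F_def S_def] AE_space
      by eventually_elim (auto simp: E_def a_def b_def split: split_indicator)
  qed (use borel_measurable_cond_exp2 in measurable)
  also have "\<dots> = (\<integral>w. a (X\<^sub>A w) \<partial>Pr) * (\<integral>w. b (X\<^sub>T w) \<partial>Pr)"
  proof (rule indep_var_lebesgue_integral)
    show "indep_var borel (\<lambda>w. a (X\<^sub>A w)) borel (\<lambda>w. b (X\<^sub>T w))"
      using indep_var_compose[OF positions_indep, of a borel b borel] by (simp add: comp_def)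
    show "integrable Pr (\<lambda>w. a (X\<^sub>A w))" "integrable Pr (\<lambda>w. b (X\<^sub>T w))"
      by (auto intro!: integrable_const_bound[where B = 1] AE_I2 simp: ab simp del: real_norm_def)
  qed
  also have "\<dots> = (\<integral>x. a x \<partial>\<mu>\<^sub>A) * (\<integral>x. b x \<partial>\<mu>\<^sub>T)"
    unfolding \<mu>\<^sub>A_def \<mu>\<^sub>T_def by (simp add: integral_distr)
  finally show ?thesis unfolding a_def b_def .
qed

text \<open>A second conditioning, on positions and states together. The states are fixed inside the
  conditioning event, so the product of Gamma probabilities is constant there and leaves the
  integral.\<close>

lemma prob_rectangle:
  assumes [measurable]: "A \<in> sets borel" "B \<in> sets borel" "U \<in> sets borel" "V \<in> sets borel"
  shows "prob {w \<in> space Pr. (K\<^sub>A w = k \<and> K\<^sub>T w = l) \<and> (X\<^sub>A w \<in> A \<and> G\<^sub>A w \<in> U) \<and> (X\<^sub>T w \<in> B \<and> G\<^sub>T w \<in> V)} =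
    (\<integral>x. indicator A x * link_prob N k (abs_dist N x) \<partial>\<mu>\<^sub>A) * measure (gain_distribution N k) U *
    ((\<integral>x. indicator B x * link_prob N l (abs_dist N x) \<partial>\<mu>\<^sub>T) * measure (gain_distribution N l) V)"
proof -
  note [measurable] = X_measurable K_measurable G_measurable
  let ?M = "((borel \<Otimes>\<^sub>M borel) \<Otimes>\<^sub>M (count_space UNIV \<Otimes>\<^sub>M count_space UNIV)) :: (((real \<times> real) \<times> (real \<times> real)) \<times> (link_state \<times> link_state)) measure"
  define F where "F = vimage_algebra (space Pr) (\<lambda>w. ((X\<^sub>A w, X\<^sub>T w), (K\<^sub>A w, K\<^sub>T w))) ?M"
  interpret F: finite_measure_subalgebra Pr F
  proof
    show "subalgebra Pr F"
      unfolding subalgebra_def F_def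
      by (auto simp: sets_vimage_algebra2 space_pair_measure intro!: measurable_sets[of _ Pr ?M])
  qed
  define E where "E = {w \<in> space Pr. X\<^sub>A w \<in> A \<and> X\<^sub>T w \<in> B \<and> K\<^sub>A w = k \<and> K\<^sub>T w = l}"
  define S where "S = {w \<in> space Pr. G\<^sub>A w \<in> U \<and> G\<^sub>T w \<in> V}"
  have E: "E \<in> sets F"
  proof -
    have "E = (\<lambda>w. ((X\<^sub>A w, X\<^sub>T w), (K\<^sub>A w, K\<^sub>T w))) -` ((A \<times> B) \<times> ({k} \<times> {l})) \<inter> space Pr" by (auto simp: E_def)
    moreover have "(A \<times> B) \<times> ({k} \<times> {l}) \<in> sets ?M" by (intro pair_measureI) auto
    ultimately show ?thesis unfolding F_def by (auto intro: in_vimage_algebra)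
  qed
  have [measurable]: "E \<in> events" "S \<in> events" unfolding E_def S_def by measurable
  let ?c = "measure (gain_distribution N k) U * measure (gain_distribution N l) V"
  have "prob {w \<in> space Pr. (K\<^sub>A w = k \<and> K\<^sub>T w = l) \<and> (X\<^sub>A w \<in> A \<and> G\<^sub>A w \<in> U) \<and> (X\<^sub>T w \<in> B \<and> G\<^sub>T w \<in> V)} = prob (E \<inter> S)"
    by (rule arg_cong[where f = prob]) (auto simp: E_def S_def)
  also have "\<dots> = (\<integral>w\<in>E. indicator S w \<partial>Pr)"
    unfolding set_lebesgue_integral_def by (simp add: indicator_inter_arith[symmetric] mult.commute)
  also have "\<dots> = (\<integral>w\<in>E. real_cond_exp Pr F (indicator S) w \<partial>Pr)"
    using E by (intro F.real_cond_exp_intA) (auto simp: emeasure_eq_measure)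
  also have "\<dots> = (\<integral>w. indicator E w * ?c \<partial>Pr)"
    unfolding set_lebesgue_integral_def
  proof (rule integral_cong_AE)
    show "AE w in Pr. indicator E w *\<^sub>R real_cond_exp Pr F (indicator S) w = indicator E w * ?c"
      using gains_given_positions_and_states[OF assms(3,4), folded F_def S_def] AE_space
      by eventually_elim (auto simp: E_def split: split_indicator)
  qed (use borel_measurable_cond_exp2 in measurable)
  also have "\<dots> = prob E * ?c"
    by simp
  finally show ?thesis
    unfolding E_def by (simp add: prob_positions_states mult_ac)
qed

definition "link_event k l = {w \<in> space Pr. K\<^sub>A w = k \<and> K\<^sub>T w = l}"

lemma measurable_pairs [measurable]:
  "(\<lambda>w. (X\<^sub>A w, G\<^sub>A w)) \<in> Pr \<rightarrow>\<^sub>M borel \<Otimes>\<^sub>M borel" "(\<lambda>w. (X\<^sub>T w, G\<^sub>T w)) \<in> Pr \<rightarrow>\<^sub>M borel \<Otimes>\<^sub>M borel"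
  using X_measurable G_measurable by simp_all

lemma link_event [measurable]: "link_event k l \<in> events"
  using K_measurable unfolding link_event_def by measurable

lemma finite_measure_link_law:
  assumes "sets \<mu> = sets borel" "prob_space \<mu>"
  shows "finite_measure (link_law N \<mu> k)"
proof
  have "emeasure (link_law N \<mu> k) (UNIV \<times> UNIV) \<noteq> \<infinity>"
    by (subst emeasure_link_law_rectangle) (use assms in auto)
  then show "emeasure (link_law N \<mu> k) (space (link_law N \<mu> k)) \<noteq> \<infinity>"
    using sets_eq_imp_space_eq[OF assms(1)] by (simp add: link_law_def space_pair_measure)
qed

section \<open>From rectangles to the product law\<close>

text \<open>\<open>prob_rectangle\<close> is extended one transmitter at a time. With the TsUE
  confined to a rectangle, both sides are finite measures in E that agree on rectangles; for
  arbitrary E the same argument then runs in F.\<close>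

lemma emeasure_link_event:
  assumes "E \<in> sets (borel \<Otimes>\<^sub>M borel)" "F \<in> sets (borel \<Otimes>\<^sub>M borel)"
  shows "emeasure Pr {w \<in> space Pr. w \<in> link_event k l \<and> (X\<^sub>A w, G\<^sub>A w) \<in> E \<and> (X\<^sub>T w, G\<^sub>T w) \<in> F}
    = emeasure (link_law N \<mu>\<^sub>A k) E * emeasure (link_law N \<mu>\<^sub>T l) F"
proof -
  let ?P = "borel \<Otimes>\<^sub>M borel :: ((real \<times> real) \<times> real) measure"
  let ?A = "link_law N \<mu>\<^sub>A k" and ?T = "link_law N \<mu>\<^sub>T l"
  note [measurable] = X_measurable K_measurable G_measurable
  have fin: "finite_measure ?A" "finite_measure ?T"
    using prob_space_mu by (auto intro: finite_measure_link_law)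
  have step: "emeasure Pr {w \<in> space Pr. w \<in> link_event k l \<and> (X\<^sub>A w, G\<^sub>A w) \<in> E \<and> (X\<^sub>T w, G\<^sub>T w) \<in> B \<times> V}
      = emeasure ?A E * emeasure ?T (B \<times> V)"
    if [measurable]: "E \<in> sets ?P" and [measurable]: "B \<in> sets borel" "V \<in> sets borel" for E B V
  proof -
    \<comment> \<open>\<open>Q\<close> collects the link states and the constraint on the TsUE, so
      that only the pair of the AsD varies.\<close>
    define Q where "Q = {w \<in> space Pr. w \<in> link_event k l \<and> (X\<^sub>T w, G\<^sub>T w) \<in> B \<times> V}"
    have [measurable]: "Q \<in> events" unfolding Q_def by measurable
    have "distr (density Pr (indicator Q)) ?P (\<lambda>w. (X\<^sub>A w, G\<^sub>A w)) = scale_measure (emeasure ?T (B \<times> V)) ?A"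
    proof (rule measure_eqI_rectangles[of _ borel borel])
      show "finite_measure (distr (density Pr (indicator Q)) ?P (\<lambda>w. (X\<^sub>A w, G\<^sub>A w)))"
        by (rule finite_measureI) (simp add: emeasure_distr_density_indicator emeasure_finite)
      fix A :: "(real \<times> real) set" and U :: "real set" assume [measurable]: "A \<in> sets borel" "U \<in> sets borel"
      have "{w \<in> space Pr. w \<in> Q \<and> (X\<^sub>A w, G\<^sub>A w) \<in> A \<times> U} =
        {w \<in> space Pr. (K\<^sub>A w = k \<and> K\<^sub>T w = l) \<and> (X\<^sub>A w \<in> A \<and> G\<^sub>A w \<in> U) \<and> (X\<^sub>T w \<in> B \<and> G\<^sub>T w \<in> V)}"
        by (auto simp: Q_def link_event_def)
      moreover have "0 \<le> (\<integral>x. indicator C x * link_prob N j (abs_dist N x) \<partial>\<mu>)" for C j \<mu>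
        by (intro integral_nonneg_AE) (simp add: link_prob_nonneg height_le_abs_dist)
      moreover note prob_rectangle[of A B U V k l]
      ultimately show "emeasure (distr (density Pr (indicator Q)) ?P (\<lambda>w. (X\<^sub>A w, G\<^sub>A w))) (A \<times> U) =
          emeasure (scale_measure (emeasure ?T (B \<times> V)) ?A) (A \<times> U)"
        by (simp add: emeasure_distr_density_indicator emeasure_eq_measure
          emeasure_link_law_rectangle prob_space_mu ennreal_mult mult_ac)
    qed simp_all
    then have "emeasure (distr (density Pr (indicator Q)) ?P (\<lambda>w. (X\<^sub>A w, G\<^sub>A w))) E = emeasure ?A E * emeasure ?T (B \<times> V)"
      by (simp add: mult.commute)
    moreover have "{w \<in> space Pr. w \<in> Q \<and> (X\<^sub>A w, G\<^sub>A w) \<in> E} =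
      {w \<in> space Pr. w \<in> link_event k l \<and> (X\<^sub>A w, G\<^sub>A w) \<in> E \<and> (X\<^sub>T w, G\<^sub>T w) \<in> B \<times> V}"
      by (auto simp: Q_def)
    ultimately show ?thesis by (simp add: emeasure_distr_density_indicator)
  qed
  note [measurable] = assms
  \<comment> \<open>The roles are exchanged: E is frozen in \<open>Q\<close>, and
    \<open>step\<close> supplies the agreement on rectangles.\<close>
  define Q where "Q = {w \<in> space Pr. w \<in> link_event k l \<and> (X\<^sub>A w, G\<^sub>A w) \<in> E}"
  have [measurable]: "Q \<in> events" unfolding Q_def by measurable
  have "distr (density Pr (indicator Q)) ?P (\<lambda>w. (X\<^sub>T w, G\<^sub>T w)) = scale_measure (emeasure ?A E) ?T"
  proof (rule measure_eqI_rectangles[of _ borel borel])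
    show "finite_measure (distr (density Pr (indicator Q)) ?P (\<lambda>w. (X\<^sub>T w, G\<^sub>T w)))"
      by (rule finite_measureI) (simp add: emeasure_distr_density_indicator emeasure_finite)
    fix B :: "(real \<times> real) set" and V :: "real set" assume [measurable]: "B \<in> sets borel" "V \<in> sets borel"
    have "{w \<in> space Pr. w \<in> Q \<and> (X\<^sub>T w, G\<^sub>T w) \<in> B \<times> V} =
      {w \<in> space Pr. w \<in> link_event k l \<and> (X\<^sub>A w, G\<^sub>A w) \<in> E \<and> (X\<^sub>T w, G\<^sub>T w) \<in> B \<times> V}"
      by (auto simp: Q_def)
    then show "emeasure (distr (density Pr (indicator Q)) ?P (\<lambda>w. (X\<^sub>T w, G\<^sub>T w))) (B \<times> V) =
        emeasure (scale_measure (emeasure ?A E) ?T) (B \<times> V)"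
      using step[of E B V] by (simp add: emeasure_distr_density_indicator)
  qed simp_all
  then have "emeasure (distr (density Pr (indicator Q)) ?P (\<lambda>w. (X\<^sub>T w, G\<^sub>T w))) F = emeasure ?A E * emeasure ?T F"
    by simp
  moreover have "{w \<in> space Pr. w \<in> Q \<and> (X\<^sub>T w, G\<^sub>T w) \<in> F} =
    {w \<in> space Pr. w \<in> link_event k l \<and> (X\<^sub>A w, G\<^sub>A w) \<in> E \<and> (X\<^sub>T w, G\<^sub>T w) \<in> F}"
    by (auto simp: Q_def)
  ultimately show ?thesis by (simp add: emeasure_distr_density_indicator)
qed

text \<open>This is the independence of the two transmitters: on each of the four state events the
  unnormalised joint law is a product.\<close>

lemma distr_link_event:
  "distr (density Pr (indicator (link_event k l))) ((borel \<Otimes>\<^sub>M borel) \<Otimes>\<^sub>M (borel \<Otimes>\<^sub>M borel))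
      (\<lambda>w. ((X\<^sub>A w, G\<^sub>A w), (X\<^sub>T w, G\<^sub>T w)))
    = link_law N \<mu>\<^sub>A k \<Otimes>\<^sub>M link_law N \<mu>\<^sub>T l"
proof (rule pair_measure_eqI[symmetric])
  show "sigma_finite_measure (link_law N \<mu>\<^sub>A k)" "sigma_finite_measure (link_law N \<mu>\<^sub>T l)"
    using prob_space_mu by (auto intro!: finite_measure_link_law finite_measure.sigma_finite_measure)
  fix E F assume "E \<in> sets (link_law N \<mu>\<^sub>A k)" "F \<in> sets (link_law N \<mu>\<^sub>T l)"
  then have [measurable]: "E \<in> sets (borel \<Otimes>\<^sub>M borel)" "F \<in> sets (borel \<Otimes>\<^sub>M borel)" by simp_all
  have "{w \<in> space Pr. w \<in> link_event k l \<and> ((X\<^sub>A w, G\<^sub>A w), (X\<^sub>T w, G\<^sub>T w)) \<in> E \<times> F} =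
    {w \<in> space Pr. w \<in> link_event k l \<and> (X\<^sub>A w, G\<^sub>A w) \<in> E \<and> (X\<^sub>T w, G\<^sub>T w) \<in> F}" by auto
  then show "emeasure (link_law N \<mu>\<^sub>A k) E * emeasure (link_law N \<mu>\<^sub>T l) F =
    emeasure (distr (density Pr (indicator (link_event k l))) ((borel \<Otimes>\<^sub>M borel) \<Otimes>\<^sub>M (borel \<Otimes>\<^sub>M borel))
      (\<lambda>w. ((X\<^sub>A w, G\<^sub>A w), (X\<^sub>T w, G\<^sub>T w)))) (E \<times> F)"
    by (subst emeasure_distr_density_indicator) (simp_all add: emeasure_link_event)
qed (simp cong: sets_pair_measure_cong)

lemma nn_integral_links:
  assumes [measurable]: "\<And>k l. \<Phi> k l \<in> borel_measurable ((borel \<Otimes>\<^sub>M borel) \<Otimes>\<^sub>M (borel \<Otimes>\<^sub>M borel))"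
  shows "(\<integral>\<^sup>+ w. \<Phi> (K\<^sub>A w) (K\<^sub>T w) ((X\<^sub>A w, G\<^sub>A w), (X\<^sub>T w, G\<^sub>T w)) \<partial>Pr) =
    (\<Sum>k\<in>{LOS, NLOS}. \<Sum>l\<in>{LOS, NLOS}. \<integral>\<^sup>+ a. (\<integral>\<^sup>+ t. \<Phi> k l (a, t) \<partial>link_law N \<mu>\<^sub>T l) \<partial>link_law N \<mu>\<^sub>A k)"
proof -
  have *: "(\<integral>\<^sup>+ a. (\<integral>\<^sup>+ t. \<Phi> k l (a, t) \<partial>link_law N \<mu>\<^sub>T l) \<partial>link_law N \<mu>\<^sub>A k) =
    (\<integral>\<^sup>+ w. indicator (link_event k l) w * \<Phi> k l ((X\<^sub>A w, G\<^sub>A w), (X\<^sub>T w, G\<^sub>T w)) \<partial>Pr)" for k l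
  proof -
    interpret T: sigma_finite_measure "link_law N \<mu>\<^sub>T l"
      using prob_space_mu by (auto intro!: finite_measure_link_law finite_measure.sigma_finite_measure)
    have "(\<integral>\<^sup>+ a. (\<integral>\<^sup>+ t. \<Phi> k l (a, t) \<partial>link_law N \<mu>\<^sub>T l) \<partial>link_law N \<mu>\<^sub>A k) =
      (\<integral>\<^sup>+ p. \<Phi> k l p \<partial>(link_law N \<mu>\<^sub>A k \<Otimes>\<^sub>M link_law N \<mu>\<^sub>T l))"
      by (rule T.nn_integral_fst) simp
    also have "\<dots> = (\<integral>\<^sup>+ w. indicator (link_event k l) w * \<Phi> k l ((X\<^sub>A w, G\<^sub>A w), (X\<^sub>T w, G\<^sub>T w)) \<partial>Pr)"
      unfolding distr_link_event[symmetric]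
      by (subst nn_integral_distr) (simp_all add: nn_integral_density)
    finally show ?thesis .
  qed
  have "(\<integral>\<^sup>+ w. \<Phi> (K\<^sub>A w) (K\<^sub>T w) ((X\<^sub>A w, G\<^sub>A w), (X\<^sub>T w, G\<^sub>T w)) \<partial>Pr) =
    (\<integral>\<^sup>+ w. (\<Sum>k\<in>{LOS, NLOS}. \<Sum>l\<in>{LOS, NLOS}. indicator (link_event k l) w * \<Phi> k l ((X\<^sub>A w, G\<^sub>A w), (X\<^sub>T w, G\<^sub>T w))) \<partial>Pr)"
  proof (rule nn_integral_cong)
    fix w assume "w \<in> space Pr"
    then show "\<Phi> (K\<^sub>A w) (K\<^sub>T w) ((X\<^sub>A w, G\<^sub>A w), (X\<^sub>T w, G\<^sub>T w)) =
      (\<Sum>k\<in>{LOS, NLOS}. \<Sum>l\<in>{LOS, NLOS}. indicator (link_event k l) w * \<Phi> k l ((X\<^sub>A w, G\<^sub>A w), (X\<^sub>T w, G\<^sub>T w)))"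
      by (cases "K\<^sub>A w"; cases "K\<^sub>T w") (simp_all add: link_event_def indicator_def)
  qed
  also have "\<dots> = (\<Sum>k\<in>{LOS, NLOS}. \<Sum>l\<in>{LOS, NLOS}. \<integral>\<^sup>+ w. indicator (link_event k l) w * \<Phi> k l ((X\<^sub>A w, G\<^sub>A w), (X\<^sub>T w, G\<^sub>T w)) \<partial>Pr)"
    by (simp only: sum.insert finite.intros sum.empty link_state.distinct insert_iff empty_iff simp_thms) (simp add: nn_integral_add)
  finally show ?thesis unfolding * .
qed

end

section \<open>Coverage as a mixture over the interference\<close>

context uplink_model
begin

lemma nn_integral_link_law:
  assumes "sets \<mu> = sets borel" and [measurable]: "\<psi> \<in> borel_measurable (borel \<Otimes>\<^sub>M borel)"
  shows "(\<integral>\<^sup>+ t. \<psi> t \<partial>link_law N \<mu> l) =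
    (\<integral>\<^sup>+ x. ennreal (link_prob N l (abs_dist N x)) * (\<integral>\<^sup>+ g. \<psi> (x, g) \<partial>gain_distribution N l) \<partial>\<mu>)"
proof -
  note [measurable_cong] = assms(1)
  interpret g: prob_space "gain_distribution N l" by (rule prob_space_gain_distribution)
  show ?thesis
    unfolding link_law_def
    by (subst g.nn_integral_fst[symmetric]) (simp_all add: nn_integral_density)
qed

lemma AE_gain_nonneg: "AE g in gain_distribution N k. 0 \<le> g"
  unfolding gain_distribution_def
  by (subst AE_density) (auto simp: erlang_density_def)

section \<open>The law of the interference power\<close>

definition interference :: "link_state \<Rightarrow> (real \<times> real) \<times> real \<Rightarrow> real" where
  "interference l t = P_TsUE N (fst t) * snd t * path_loss N l (abs_dist N (fst t))"

lemma abs_dist_measurable [measurable]: "abs_dist N \<in> borel_measurable borel"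
  unfolding abs_dist_eq[abs_def] by measurable

lemma interference_measurable [measurable]: "interference l \<in> borel_measurable (borel \<Otimes>\<^sub>M borel)"
  unfolding interference_def[abs_def] P_TsUE_def path_loss_def by measurable

lemma path_loss_pos: "z > 0 \<Longrightarrow> path_loss N k z > 0"
  by (simp add: path_loss_def eta_pos)

lemma P_TsUE_nonneg: "P_TsUE N y \<ge> 0"
  using rho_T_pos by (simp add: P_TsUE_def)

text \<open>The TsUE enters the SINR only through its interference, so expectations over its
  position, state and gain become integrals over the line against this law.\<close>

definition J :: "real measure" where
  "J = distr Pr borel (\<lambda>w. interference (K\<^sub>T w) (X\<^sub>T w, G\<^sub>T w))"

lemma interference_state_measurable [measurable]:
  "(\<lambda>w. interference (K\<^sub>T w) (X\<^sub>T w, G\<^sub>T w)) \<in> borel_measurable Pr"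
proof -
  have "(\<lambda>w. interference (K\<^sub>T w) (X\<^sub>T w, G\<^sub>T w)) = (\<lambda>w. if K\<^sub>T w = LOS then interference LOS (X\<^sub>T w, G\<^sub>T w)
    else interference NLOS (X\<^sub>T w, G\<^sub>T w))"
    by (rule ext) (metis link_state.exhaust)
  also have "\<dots> \<in> borel_measurable Pr"
    using K_measurable by measurable
  finally show ?thesis .
qed

lemma J: "prob_space J" "sets J = sets borel"
  unfolding J_def by (auto intro: prob_space_distr)

lemma emeasure_link_law_states:
  "(\<Sum>k\<in>{LOS, NLOS}. emeasure (link_law N \<mu>\<^sub>A k) (space (link_law N \<mu>\<^sub>A k))) = 1"
proof -
  have "(\<integral>\<^sup>+ w. 1 \<partial>Pr) = (\<Sum>k\<in>{LOS, NLOS}. \<integral>\<^sup>+ a. 1 \<partial>link_law N \<mu>\<^sub>A k)"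
  proof -
    have "(\<Sum>k\<in>{LOS, NLOS}. \<integral>\<^sup>+ a. 1 \<partial>link_law N \<mu>\<^sub>A k) =
      (\<Sum>k\<in>{LOS, NLOS}. \<integral>\<^sup>+ x. ennreal (link_prob N k (abs_dist N x)) \<partial>\<mu>\<^sub>A)"
      using prob_space.emeasure_space_1[OF prob_space_gain_distribution]
      by (intro sum.cong refl, subst nn_integral_link_law) simp_all
    also have "\<dots> = (\<integral>\<^sup>+ x. 1 \<partial>\<mu>\<^sub>A)"
      by (simp add: nn_integral_add[symmetric] ennreal_plus[symmetric] link_prob_nonneg height_le_abs_dist link_prob_sum del: ennreal_plus)
    finally show ?thesis using prob_space_mu by (simp add: emeasure_space_1 prob_space.emeasure_space_1)
  qed
  then show ?thesis by (simp add: emeasure_space_1)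
qed

text \<open>The integrand does not involve the AsD, whose contribution in
  \<open>nn_integral_links\<close> is therefore the total mass of its two link laws, which is
  1.\<close>

lemma nn_integral_J:
  assumes [measurable]: "\<phi> \<in> borel_measurable borel"
  shows "(\<integral>\<^sup>+ i. \<phi> i \<partial>J) = (\<Sum>l\<in>{LOS, NLOS}. \<integral>\<^sup>+ t. \<phi> (interference l t) \<partial>link_law N \<mu>\<^sub>T l)"
proof -
  have "(\<integral>\<^sup>+ i. \<phi> i \<partial>J) = (\<integral>\<^sup>+ w. \<phi> (interference (K\<^sub>T w) (X\<^sub>T w, G\<^sub>T w)) \<partial>Pr)"
    unfolding J_def by (rule nn_integral_distr) simp_all
  also have "\<dots> = (\<Sum>k\<in>{LOS, NLOS}. \<Sum>l\<in>{LOS, NLOS}. \<integral>\<^sup>+ a. (\<integral>\<^sup>+ t. \<phi> (interference l t) \<partial>link_law N \<mu>\<^sub>T l) \<partial>link_law N \<mu>\<^sub>A k)"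
    using nn_integral_links[of "\<lambda>k l p. \<phi> (interference l (snd p))"] by simp
  also have "\<dots> = (\<Sum>k\<in>{LOS, NLOS}. emeasure (link_law N \<mu>\<^sub>A k) (space (link_law N \<mu>\<^sub>A k)))
      * (\<Sum>l\<in>{LOS, NLOS}. \<integral>\<^sup>+ t. \<phi> (interference l t) \<partial>link_law N \<mu>\<^sub>T l)"
    by (simp add: algebra_simps)
  finally show ?thesis by (simp only: emeasure_link_law_states mult_1)
qed

lemma AE_J_nonneg: "AE i in J. 0 \<le> i"
proof -
  have "(\<integral>\<^sup>+ i. indicator {..<0} i \<partial>J) = 0"
  proof -
    have "(\<integral>\<^sup>+ t. indicator {..<0} (interference l t) \<partial>link_law N \<mu>\<^sub>T l) = 0" for l
    proof -
      have "(\<integral>\<^sup>+ g. indicator {..<0} (interference l (x, g)) \<partial>gain_distribution N l) = 0" for x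
      proof (rule nn_integral_0_iff_AE[THEN iffD2])
        show "AE g in gain_distribution N l. indicator {..<0} (interference l (x, g)) = (0::ennreal)"
          using AE_gain_nonneg
        proof eventually_elim
          fix g :: real assume "0 \<le> g"
          then have "interference l (x, g) \<ge> 0"
            using P_TsUE_nonneg path_loss_pos[of "abs_dist N x" l] height_le_abs_dist[of N x] height_pos
            by (simp add: interference_def less_imp_le)
          then show "indicator {..<0} (interference l (x, g)) = (0::ennreal)" by simp
        qed
      qed measurable
      then show ?thesis by (subst nn_integral_link_law) simp_all
    qed
    then show ?thesis by (subst nn_integral_J) simp_all
  qed
  then have "AE i in J. indicator {..<0} i = (0::ennreal)"
    by (subst (asm) nn_integral_0_iff_AE) (simp_all add: measurable_cong_sets[OF J(2) refl])
  then show ?thesis by eventually_elim (auto split: split_indicator_asm)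
qed

text \<open>The Laplace transform of the interference given the TsUE position: the transform (m / (m
  + c))^m of a unit-mean Gamma gain of shape m, averaged over the link state.\<close>

definition station_laplace :: "real \<Rightarrow> real \<times> real \<Rightarrow> real" where
  "station_laplace s y = (\<Sum>l\<in>{LOS, NLOS}. link_prob N l (abs_dist N y) *
     (real (m\<^sub>a N l) / (real (m\<^sub>a N l) + s * P_TsUE N y * path_loss N l (abs_dist N y))) ^ m\<^sub>a N l)"

lemma nn_integral_exp_J:
  assumes "s \<ge> 0"
  shows "(\<integral>\<^sup>+ i. ennreal (exp (- (s * i))) \<partial>J) = (\<integral>\<^sup>+ y. ennreal (station_laplace s y) \<partial>\<mu>\<^sub>T)"
proof -
  define b where "b l y = (real (m\<^sub>a N l) / (real (m\<^sub>a N l) + s * P_TsUE N y * path_loss N l (abs_dist N y))) ^ m\<^sub>a N l" for l y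
  have b0: "b l y \<ge> 0" for l y
    using assms P_TsUE_nonneg path_loss_pos[of "abs_dist N y" l] height_le_abs_dist[of N y] height_pos
    by (auto simp: b_def intro!: zero_le_power divide_nonneg_nonneg add_nonneg_nonneg mult_nonneg_nonneg less_imp_le)
  have [measurable]: "b l \<in> borel_measurable borel" for l
    unfolding b_def[abs_def] P_TsUE_def path_loss_def by measurable
  have "(\<integral>\<^sup>+ g. ennreal (exp (- (s * interference l (y, g)))) \<partial>gain_distribution N l) = ennreal (b l y)" for l y
  proof -
    have "0 \<le> s * P_TsUE N y * path_loss N l (abs_dist N y)"
      using assms P_TsUE_nonneg path_loss_pos[of "abs_dist N y" l] height_le_abs_dist[of N y] height_pos
      by simp
    then show ?thesis
      using nn_integral_exp_erlang[of "real (m\<^sub>a N l)" "s * P_TsUE N y * path_loss N l (abs_dist N y)" "m\<^sub>a N l - 1"] m_pos[of l]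
      by (simp add: gain_distribution_def interference_def b_def mult_ac)
  qed
  then have "(\<integral>\<^sup>+ i. ennreal (exp (- (s * i))) \<partial>J) = (\<Sum>l\<in>{LOS, NLOS}. \<integral>\<^sup>+ y. ennreal (link_prob N l (abs_dist N y)) * ennreal (b l y) \<partial>\<mu>\<^sub>T)"
    by (subst nn_integral_J; simp add: nn_integral_link_law)
  also have "\<dots> = (\<integral>\<^sup>+ y. ennreal (station_laplace s y) \<partial>\<mu>\<^sub>T)"
    by (simp add: nn_integral_add[symmetric] ennreal_plus[symmetric] ennreal_mult[symmetric] b0 link_prob_nonneg height_le_abs_dist
        station_laplace_def b_def[symmetric] del: ennreal_plus)
  finally show ?thesis .
qed

section \<open>Coverage given the interference\<close>

text \<open>For t \<ge> 0 and m > 0: the probability that a Poisson variable of mean t is below m,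
  equally that a Gamma variable of shape m and rate 1 exceeds t.\<close>

definition poisson_tail :: "nat \<Rightarrow> real \<Rightarrow> real" where
  "poisson_tail m t = (\<Sum>n<m. t ^ n / fact n * exp (- t))"

lemma poisson_tail_measurable [measurable]: "poisson_tail m \<in> borel_measurable borel"
  unfolding poisson_tail_def[abs_def] by measurable

lemma poisson_tail_nonneg: "t \<ge> 0 \<Longrightarrow> poisson_tail m t \<ge> 0"
  unfolding poisson_tail_def by (intro sum_nonneg) simp

lemma emeasure_gain_greaterThan:
  assumes "t \<ge> 0"
  shows "emeasure (gain_distribution N k) {t<..} = ennreal (poisson_tail (m\<^sub>a N k) (real (m\<^sub>a N k) * t))"
  using emeasure_erlang_greaterThan[of "real (m\<^sub>a N k)" t "m\<^sub>a N k - 1"] assms m_pos[of k]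
  by (simp add: gain_distribution_def poisson_tail_def)

lemma P_AsD_pos: "z > 0 \<Longrightarrow> P_AsD N k z > 0"
  using P_M_pos rho_A_pos eta_pos by (simp add: P_AsD_def)

lemma s_arg_pos: "\<gamma> > 0 \<Longrightarrow> z > 0 \<Longrightarrow> p > 0 \<Longrightarrow> s_arg N \<gamma> k p z > 0"
  using m_pos eta_pos by (simp add: s_arg_def)

lemma P_AsD_measurable [measurable]: "P_AsD N k \<in> borel_measurable borel"
  unfolding P_AsD_def[abs_def] by measurable

lemma s_arg_measurable [measurable]: "(\<lambda>z. s_arg N \<gamma> k (P_AsD N k z) z) \<in> borel_measurable borel"
  unfolding s_arg_def by measurable

text \<open>For given nonnegative interference, coverage is a lower bound on the gain of the AsD.
  Integrating this gain before the interference therefore leaves a Gamma tail.\<close>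

lemma emeasure_coverage:
  assumes \<gamma>: "\<gamma> > 0"
  shows "emeasure Pr {w \<in> space Pr. SINR N (X\<^sub>A w) (K\<^sub>A w) (G\<^sub>A w) (X\<^sub>T w) (K\<^sub>T w) (G\<^sub>T w) > \<gamma>} =
    (\<Sum>k\<in>{LOS, NLOS}. \<integral>\<^sup>+ x. ennreal (link_prob N k (abs_dist N x)) *
       (\<integral>\<^sup>+ i. ennreal (poisson_tail (m\<^sub>a N k) (s_arg N \<gamma> k (P_AsD N k (abs_dist N x)) (abs_dist N x) * (i + noise_power N))) \<partial>J) \<partial>\<mu>\<^sub>A)"
proof -
  interpret J: prob_space J by (rule J)
  note [measurable_cong] = J(2)
  define c where "c k x = P_AsD N k (abs_dist N x) * path_loss N k (abs_dist N x)" for k x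
  have c_pos: "c k x > 0" for k x
    using height_le_abs_dist[of N x] height_pos by (simp add: c_def P_AsD_pos path_loss_pos)
  have [measurable]: "c k \<in> borel_measurable borel" for k
    unfolding c_def[abs_def] path_loss_def by measurable
  \<comment> \<open>The coverage indicator as a function of the pair of the AsD and of the value i
    of the interference alone, which lets \<open>nn_integral_J\<close> absorb the TsUE.\<close>
  define \<xi> :: "link_state \<Rightarrow> (real \<times> real) \<times> real \<Rightarrow> real \<Rightarrow> ennreal" where
    "\<xi> k a i = indicator {\<gamma><..} (c k (fst a) * snd a / (i + noise_power N))" for k a i
  have \<xi>m[measurable]: "(\<lambda>p. \<xi> k (fst p) (snd p)) \<in> borel_measurable ((borel \<Otimes>\<^sub>M borel) \<Otimes>\<^sub>M borel)" for k
    unfolding \<xi>_def by measurable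
  have m1: "(\<lambda>p. \<xi> k (fst p) (interference l (snd p))) \<in> borel_measurable ((borel \<Otimes>\<^sub>M borel) \<Otimes>\<^sub>M (borel \<Otimes>\<^sub>M borel))" for k l
    unfolding \<xi>_def by measurable
  have SINR: "indicator {w \<in> space Pr. SINR N (X\<^sub>A w) (K\<^sub>A w) (G\<^sub>A w) (X\<^sub>T w) (K\<^sub>T w) (G\<^sub>T w) > \<gamma>} w =
      \<xi> (K\<^sub>A w) (X\<^sub>A w, G\<^sub>A w) (interference (K\<^sub>T w) (X\<^sub>T w, G\<^sub>T w))" if "w \<in> space Pr" for w
    using that by (simp add: SINR_def \<xi>_def interference_def c_def indicator_def mult_ac)
  have "(\<lambda>w. \<xi> (K\<^sub>A w) (X\<^sub>A w, G\<^sub>A w) (interference (K\<^sub>T w) (X\<^sub>T w, G\<^sub>T w))) \<in> borel_measurable Pr"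
  proof -
    have "(\<lambda>w. \<xi> (K\<^sub>A w) (X\<^sub>A w, G\<^sub>A w) (interference (K\<^sub>T w) (X\<^sub>T w, G\<^sub>T w))) = (\<lambda>w.
      if K\<^sub>A w = LOS then \<xi> LOS (X\<^sub>A w, G\<^sub>A w) (interference (K\<^sub>T w) (X\<^sub>T w, G\<^sub>T w))
      else \<xi> NLOS (X\<^sub>A w, G\<^sub>A w) (interference (K\<^sub>T w) (X\<^sub>T w, G\<^sub>T w)))"
      by (rule ext) (metis link_state.exhaust)
    also have "\<dots> \<in> borel_measurable Pr"
      unfolding \<xi>_def using K_measurable X_measurable G_measurable by measurable
    finally show ?thesis .
  qed
  then have "{w \<in> space Pr. \<xi> (K\<^sub>A w) (X\<^sub>A w, G\<^sub>A w) (interference (K\<^sub>T w) (X\<^sub>T w, G\<^sub>T w)) = 1} \<in> events"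
    by measurable
  also have "{w \<in> space Pr. \<xi> (K\<^sub>A w) (X\<^sub>A w, G\<^sub>A w) (interference (K\<^sub>T w) (X\<^sub>T w, G\<^sub>T w)) = 1} =
      {w \<in> space Pr. SINR N (X\<^sub>A w) (K\<^sub>A w) (G\<^sub>A w) (X\<^sub>T w) (K\<^sub>T w) (G\<^sub>T w) > \<gamma>}"
    by (auto simp: SINR[symmetric] split: split_indicator_asm)
  finally have "emeasure Pr {w \<in> space Pr. SINR N (X\<^sub>A w) (K\<^sub>A w) (G\<^sub>A w) (X\<^sub>T w) (K\<^sub>T w) (G\<^sub>T w) > \<gamma>} =
    (\<integral>\<^sup>+ w. \<xi> (K\<^sub>A w) (X\<^sub>A w, G\<^sub>A w) (interference (K\<^sub>T w) (X\<^sub>T w, G\<^sub>T w)) \<partial>Pr)"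
    by (intro nn_integral_indicator[symmetric, THEN trans] nn_integral_cong SINR)
  also have "\<dots> = (\<Sum>k\<in>{LOS, NLOS}. \<Sum>l\<in>{LOS, NLOS}. \<integral>\<^sup>+ a. (\<integral>\<^sup>+ t. \<xi> k a (interference l t) \<partial>link_law N \<mu>\<^sub>T l) \<partial>link_law N \<mu>\<^sub>A k)"
    using nn_integral_links[of "\<lambda>k l p. \<xi> k (fst p) (interference l (snd p))", OF m1] by simp
  also have "\<dots> = (\<Sum>k\<in>{LOS, NLOS}. \<integral>\<^sup>+ a. (\<integral>\<^sup>+ i. \<xi> k a i \<partial>J) \<partial>link_law N \<mu>\<^sub>A k)"
  proof (rule sum.cong[OF refl])
    fix k
    have m2: "(\<lambda>a. \<integral>\<^sup>+ t. \<xi> k a (interference l t) \<partial>link_law N \<mu>\<^sub>T l) \<in> borel_measurable (link_law N \<mu>\<^sub>A k)" for l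
    proof -
      interpret T: sigma_finite_measure "link_law N \<mu>\<^sub>T l"
        using prob_space_mu by (auto intro!: finite_measure_link_law finite_measure.sigma_finite_measure)
      show ?thesis using m1[of k l] by (intro T.borel_measurable_nn_integral) (simp add: case_prod_beta' cong: measurable_cong_sets)
    qed
    have "(\<integral>\<^sup>+ i. \<xi> k a i \<partial>J) = (\<Sum>l\<in>{LOS, NLOS}. \<integral>\<^sup>+ t. \<xi> k a (interference l t) \<partial>link_law N \<mu>\<^sub>T l)" for a
      by (rule nn_integral_J) (simp add: \<xi>_def)
    then show "(\<Sum>l\<in>{LOS, NLOS}. \<integral>\<^sup>+ a. (\<integral>\<^sup>+ t. \<xi> k a (interference l t) \<partial>link_law N \<mu>\<^sub>T l) \<partial>link_law N \<mu>\<^sub>A k) =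
      (\<integral>\<^sup>+ a. (\<integral>\<^sup>+ i. \<xi> k a i \<partial>J) \<partial>link_law N \<mu>\<^sub>A k)"
      using m2 by (simp add: nn_integral_add)
  qed
  also have "\<dots> = (\<Sum>k\<in>{LOS, NLOS}. \<integral>\<^sup>+ x. ennreal (link_prob N k (abs_dist N x)) *
       (\<integral>\<^sup>+ g. (\<integral>\<^sup>+ i. \<xi> k (x, g) i \<partial>J) \<partial>gain_distribution N k) \<partial>\<mu>\<^sub>A)"
    by (intro sum.cong refl nn_integral_link_law) (auto simp: \<xi>_def)
  also have "\<dots> = (\<Sum>k\<in>{LOS, NLOS}. \<integral>\<^sup>+ x. ennreal (link_prob N k (abs_dist N x)) *
       (\<integral>\<^sup>+ i. ennreal (poisson_tail (m\<^sub>a N k) (s_arg N \<gamma> k (P_AsD N k (abs_dist N x)) (abs_dist N x) * (i + noise_power N))) \<partial>J) \<partial>\<mu>\<^sub>A)"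
  proof (intro sum.cong refl nn_integral_cong arg_cong2[where f = "(*)"])
    fix k x
    interpret g: prob_space "gain_distribution N k" by (rule prob_space_gain_distribution)
    interpret gJ: pair_sigma_finite "gain_distribution N k" J ..
    have "(\<integral>\<^sup>+ g. (\<integral>\<^sup>+ i. \<xi> k (x, g) i \<partial>J) \<partial>gain_distribution N k) = (\<integral>\<^sup>+ i. (\<integral>\<^sup>+ g. \<xi> k (x, g) i \<partial>gain_distribution N k) \<partial>J)"
      by (rule gJ.Fubini'[symmetric]) (simp add: \<xi>_def case_prod_beta')
    also have "\<dots> = (\<integral>\<^sup>+ i. ennreal (poisson_tail (m\<^sub>a N k) (s_arg N \<gamma> k (P_AsD N k (abs_dist N x)) (abs_dist N x) * (i + noise_power N))) \<partial>J)"
    \<comment> \<open>Nonnegative i makes the denominator of the SINR positive, so the inequality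
      can be solved for the gain; this holds for almost every i.\<close>
    proof (rule nn_integral_cong_AE, use AE_J_nonneg in eventually_elim)
      fix i :: real assume i: "0 \<le> i"
      let ?t = "\<gamma> * (i + noise_power N) / c k x"
      have "\<xi> k (x, g) i = indicator {?t<..} g" for g
        using i noise_pos c_pos[of k x] by (simp add: \<xi>_def indicator_def pos_less_divide_eq pos_divide_less_eq mult_ac)
      then have "(\<integral>\<^sup>+ g. \<xi> k (x, g) i \<partial>gain_distribution N k) = emeasure (gain_distribution N k) {?t<..}"
        by simp
      also have "\<dots> = ennreal (poisson_tail (m\<^sub>a N k) (real (m\<^sub>a N k) * ?t))"
        using i noise_pos c_pos[of k x] \<gamma> by (intro emeasure_gain_greaterThan) simp
      also have "real (m\<^sub>a N k) * ?t = s_arg N \<gamma> k (P_AsD N k (abs_dist N x)) (abs_dist N x) * (i + noise_power N)"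
        by (simp add: s_arg_def c_def path_loss_def powr_minus field_simps)
      finally show "(\<integral>\<^sup>+ g. \<xi> k (x, g) i \<partial>gain_distribution N k) =
        ennreal (poisson_tail (m\<^sub>a N k) (s_arg N \<gamma> k (P_AsD N k (abs_dist N x)) (abs_dist N x) * (i + noise_power N)))" .
    qed
    finally show "(\<integral>\<^sup>+ g. (\<integral>\<^sup>+ i. \<xi> k (x, g) i \<partial>J) \<partial>gain_distribution N k) =
      (\<integral>\<^sup>+ i. ennreal (poisson_tail (m\<^sub>a N k) (s_arg N \<gamma> k (P_AsD N k (abs_dist N x)) (abs_dist N x) * (i + noise_power N))) \<partial>J)" .
  qed
  finally show ?thesis .
qed

text \<open>The formula for \<open>laplace N\<close> is a hypothesis because it rests on the polar
  coordinates below; \<open>laplace_eq\<close> discharges it.\<close>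

lemma cond_coverage_eq:
  assumes F: "\<And>s. s > 0 \<Longrightarrow> laplace N s = (\<integral>i. exp (- (s * i)) \<partial>J)"
    and "\<gamma> > 0" "z > 0" "p > 0"
  shows "cond_coverage N \<gamma> k p z =
    link_prob N k z * (\<integral>i. poisson_tail (m\<^sub>a N k) (s_arg N \<gamma> k p z * (i + noise_power N)) \<partial>J)"
    and "integrable J (\<lambda>i. poisson_tail (m\<^sub>a N k) (s_arg N \<gamma> k p z * (i + noise_power N)))"
proof -
  have fin: "finite_measure J" using J(1) by (simp add: prob_space_def)
  \<comment> \<open>The subtraction is truncated; positivity of the shape makes the range consist of
    exactly m indices.\<close>
  have "{0..m\<^sub>a N k - 1} = {..<m\<^sub>a N k}" using m_pos[of k] by auto
  then show "cond_coverage N \<gamma> k p z =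
    link_prob N k z * (\<integral>i. poisson_tail (m\<^sub>a N k) (s_arg N \<gamma> k p z * (i + noise_power N)) \<partial>J)"
    unfolding cond_coverage_def Let_def poisson_tail_def
    by (subst poisson_tail_laplace_transform(1)[OF fin J(2) AE_J_nonneg F s_arg_pos]) (use assms in auto)
  show "integrable J (\<lambda>i. poisson_tail (m\<^sub>a N k) (s_arg N \<gamma> k p z * (i + noise_power N)))"
    unfolding poisson_tail_def
    by (rule poisson_tail_laplace_transform(2)[OF fin J(2) AE_J_nonneg F s_arg_pos]) (use assms in auto)
qed

end

section \<open>Uniform positions in polar coordinates\<close>

text \<open>h > 0 keeps the square root differentiable at r = 0, which admits the radius a = 0
  needed for the stadium.\<close>

lemma nn_integral_radial_slant:
  assumes [measurable]: "G \<in> borel_measurable (borel :: real measure)" and "0 \<le> a" "a < b" "h > 0"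
  shows "(\<integral>\<^sup>+ r. ennreal r * G (sqrt (r\<^sup>2 + h\<^sup>2)) * indicator {a..b} r \<partial>lborel) =
    (\<integral>\<^sup>+ z. ennreal z * G z * indicator {sqrt (a\<^sup>2 + h\<^sup>2)..sqrt (b\<^sup>2 + h\<^sup>2)} z \<partial>lborel)"
proof -
  have pos: "r\<^sup>2 + h\<^sup>2 > 0" for r using \<open>h > 0\<close> by (simp add: add_nonneg_pos)
  have "(\<integral>\<^sup>+ z. ennreal z * G z * indicator {sqrt (a\<^sup>2 + h\<^sup>2)..sqrt (b\<^sup>2 + h\<^sup>2)} z \<partial>lborel) =
    (\<integral>\<^sup>+ r. (ennreal (sqrt (r\<^sup>2 + h\<^sup>2)) * G (sqrt (r\<^sup>2 + h\<^sup>2))) * ennreal (r / sqrt (r\<^sup>2 + h\<^sup>2)) * indicator {a..b} r \<partial>lborel)"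
  proof (rule nn_integral_substitution_aux[where g = "\<lambda>r. sqrt (r\<^sup>2 + h\<^sup>2)"])
    show "((\<lambda>r. sqrt (r\<^sup>2 + h\<^sup>2)) has_real_derivative r / sqrt (r\<^sup>2 + h\<^sup>2)) (at r)" for r
      using pos[of r] by (auto intro!: derivative_eq_intros simp: field_simps)
    show "continuous_on {a..b} (\<lambda>r. r / sqrt (r\<^sup>2 + h\<^sup>2))"
      using pos by (intro continuous_intros) (auto simp: less_le)
  qed (use assms pos in auto)
  also have "\<dots> = (\<integral>\<^sup>+ r. ennreal r * G (sqrt (r\<^sup>2 + h\<^sup>2)) * indicator {a..b} r \<partial>lborel)"
  proof (rule nn_integral_cong)
    fix r
    have "ennreal (sqrt (r\<^sup>2 + h\<^sup>2)) * ennreal (r / sqrt (r\<^sup>2 + h\<^sup>2)) = ennreal r"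
      using pos[of r] by (subst ennreal_mult'[symmetric]) auto
    then show "(ennreal (sqrt (r\<^sup>2 + h\<^sup>2)) * G (sqrt (r\<^sup>2 + h\<^sup>2))) * ennreal (r / sqrt (r\<^sup>2 + h\<^sup>2)) * indicator {a..b} r =
      ennreal r * G (sqrt (r\<^sup>2 + h\<^sup>2)) * indicator {a..b} r"
      by (simp only: mult.assoc[symmetric] mult.commute[of _ "ennreal (r / sqrt (r\<^sup>2 + h\<^sup>2))"])
  qed
  finally show ?thesis ..
qed

text \<open>Polar coordinates around c with the angle counted from the direction of t, so that the
  distance to t is given by the law of cosines. The radius ends up as the outer variable, in the
  order of the integrals of \<open>laplace\<close>.\<close>

lemma nn_integral_two_centers:
  fixes c t :: "real \<times> real" and F :: "real \<Rightarrow> real \<Rightarrow> ennreal"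
  assumes Fm: "case_prod F \<in> borel_measurable (borel \<Otimes>\<^sub>M borel)" and "t \<noteq> c"
  shows "(\<integral>\<^sup>+ y. F (dist y c) (dist y t) \<partial>lborel) =
    (\<integral>\<^sup>+ r. (\<integral>\<^sup>+ \<theta>. ennreal r * F r (sqrt (r\<^sup>2 + (dist t c)\<^sup>2 - 2 * r * dist t c * cos \<theta>)) *
        indicator {-pi..pi} \<theta> \<partial>lborel) * indicator {0<..} r \<partial>lborel)"
proof -
  define d where "d = dist t c"
  have d: "d > 0" using \<open>t \<noteq> c\<close> by (simp add: d_def)
  have [measurable (raw)]: "(\<lambda>x. F (f x) (g x)) \<in> borel_measurable M"
    if "f \<in> borel_measurable M" "g \<in> borel_measurable M" for f g and M :: "'m measure"
    using measurable_compose[OF measurable_Pair[OF that] Fm] by simp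
  have circle: "(fst (t - c) / d)\<^sup>2 + (snd (t - c) / d)\<^sup>2 = 1"
  proof -
    have "(fst (t - c))\<^sup>2 + (snd (t - c))\<^sup>2 = d\<^sup>2"
      by (simp add: d_def dist_norm norm_prod_def)
    then show ?thesis using d by (simp add: power_divide add_divide_distrib[symmetric])
  qed
  obtain \<phi> where \<phi>: "fst (t - c) / d = cos \<phi>" "snd (t - c) / d = sin \<phi>"
    using sincos_total_2pi[OF circle] by blast
  then have t: "t = c + (d * cos \<phi>, d * sin \<phi>)"
    using d by (simp add: prod_eq_iff field_simps)
  have dist_t: "dist (c + (r * cos \<theta>, r * sin \<theta>)) t = sqrt (r\<^sup>2 + d\<^sup>2 - 2 * r * d * cos (\<theta> - \<phi>))" for r \<theta>
  proof -
    have "dist (c + (r * cos \<theta>, r * sin \<theta>)) t = sqrt ((r * cos \<theta> - d * cos \<phi>)\<^sup>2 + (r * sin \<theta> - d * sin \<phi>)\<^sup>2)"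
      unfolding t by (simp add: dist_norm norm_prod_def)
    \<comment> \<open>With the sums of squares left unevaluated, this is a polynomial identity in
      the sines and cosines; the Pythagorean relation is applied afterwards.\<close>
    also have "(r * cos \<theta> - d * cos \<phi>)\<^sup>2 + (r * sin \<theta> - d * sin \<phi>)\<^sup>2 =
        r\<^sup>2 * ((cos \<theta>)\<^sup>2 + (sin \<theta>)\<^sup>2) + d\<^sup>2 * ((cos \<phi>)\<^sup>2 + (sin \<phi>)\<^sup>2) - 2 * r * d * cos (\<theta> - \<phi>)"
      unfolding cos_diff by algebra
    finally show ?thesis by simp
  qed
  have dist_c: "dist (c + (r * cos \<theta>, r * sin \<theta>)) c = r" if "r > 0" for r \<theta>
  proof -
    have "dist (c + (r * cos \<theta>, r * sin \<theta>)) c = sqrt (r\<^sup>2 * ((cos \<theta>)\<^sup>2 + (sin \<theta>)\<^sup>2))"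
      unfolding distrib_left by (simp add: dist_norm norm_prod_def power_mult_distrib)
    then show ?thesis using that by simp
  qed
  have "(\<integral>\<^sup>+ y. F (dist y c) (dist y t) \<partial>lborel) = (\<integral>\<^sup>+ y. F (dist y c) (dist y t) \<partial>distr lborel borel ((+) c))"
    by (simp add: lborel_distr_plus)
  also have "\<dots> = (\<integral>\<^sup>+ p. F (dist (c + p) c) (dist (c + p) t) \<partial>lborel)"
    by (rule nn_integral_distr) measurable
  \<comment> \<open>The window is centred at the direction \<open>\<phi>\<close> of t, so that the
    shift by \<open>\<phi>\<close> below lands on [- pi, pi].\<close>
  also have "\<dots> = (\<integral>\<^sup>+ \<theta>. (\<integral>\<^sup>+ r. ennreal r * F (dist (c + (r * cos \<theta>, r * sin \<theta>)) c) (dist (c + (r * cos \<theta>, r * sin \<theta>)) t)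
      * indicator {0<..} r \<partial>lborel) * indicator {\<phi> - pi..\<phi> - pi + 2*pi} \<theta> \<partial>lborel)"
    by (rule nn_integral_polar) measurable
  also have "\<dots> = (\<integral>\<^sup>+ \<theta>. (\<integral>\<^sup>+ r. ennreal r * F r (sqrt (r\<^sup>2 + d\<^sup>2 - 2 * r * d * cos (\<theta> - \<phi>)))
      * indicator {0<..} r \<partial>lborel) * indicator {\<phi> - pi..\<phi> - pi + 2*pi} \<theta> \<partial>lborel)"
  proof (rule nn_integral_cong, rule arg_cong2[where f = "(*)", OF _ refl], rule nn_integral_cong)
    fix \<theta> r
    show "ennreal r * F (dist (c + (r * cos \<theta>, r * sin \<theta>)) c) (dist (c + (r * cos \<theta>, r * sin \<theta>)) t) * indicator {0<..} r =
      ennreal r * F r (sqrt (r\<^sup>2 + d\<^sup>2 - 2 * r * d * cos (\<theta> - \<phi>))) * indicator {0<..} r"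
      using dist_c[of r \<theta>] by (cases "r > 0") (simp_all add: dist_t)
  qed
  also have "\<dots> = (\<integral>\<^sup>+ \<theta>. (\<integral>\<^sup>+ r. ennreal r * F r (sqrt (r\<^sup>2 + d\<^sup>2 - 2 * r * d * cos \<theta>))
      * indicator {0<..} r \<partial>lborel) * indicator {-pi..pi} \<theta> \<partial>lborel)"
    by (subst nn_integral_real_affine[of _ 1 \<phi>])
      (auto intro!: nn_integral_cong split: split_indicator)
  also have "\<dots> = (\<integral>\<^sup>+ \<theta>. (\<integral>\<^sup>+ r. ennreal r * F r (sqrt (r\<^sup>2 + d\<^sup>2 - 2 * r * d * cos \<theta>))
      * indicator {-pi..pi} \<theta> * indicator {0<..} r \<partial>lborel) \<partial>lborel)"
    by (subst nn_integral_multc[symmetric]) (auto simp: mult_ac)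
  also have "\<dots> = (\<integral>\<^sup>+ r. (\<integral>\<^sup>+ \<theta>. ennreal r * F r (sqrt (r\<^sup>2 + d\<^sup>2 - 2 * r * d * cos \<theta>))
      * indicator {-pi..pi} \<theta> * indicator {0<..} r \<partial>lborel) \<partial>lborel)"
    by (rule lborel_pair.Fubini') measurable
  also have "\<dots> = (\<integral>\<^sup>+ r. (\<integral>\<^sup>+ \<theta>. ennreal r * F r (sqrt (r\<^sup>2 + d\<^sup>2 - 2 * r * d * cos \<theta>))
      * indicator {-pi..pi} \<theta> \<partial>lborel) * indicator {0<..} r \<partial>lborel)"
    by (subst nn_integral_multc[symmetric]) auto
  finally show ?thesis unfolding d_def .
qed

lemma emeasure_disk: "r \<ge> 0 \<Longrightarrow> emeasure lborel (cball (c :: real \<times> real) r) = ennreal (pi * r\<^sup>2)"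
  by (simp add: emeasure_cball unit_ball_vol_2 power2_eq_square)

text \<open>For z \<ge> h, the distance to the TBS of a ground point at slant distance z from the
  ABS whose direction from the stadium centre makes the angle \<theta> with that of the TBS; sqrt
  (z^2 - h^2) is its ground radius.\<close>

definition tbs_dist :: "uplink \<Rightarrow> real \<Rightarrow> real \<Rightarrow> real" where
  "tbs_dist N z \<theta> = sqrt (z\<^sup>2 - (height N)\<^sup>2 + (center_dist N)\<^sup>2
     - 2 * sqrt (z\<^sup>2 - (height N)\<^sup>2) * center_dist N * cos \<theta>)"

lemma tbs_dist_measurable [measurable]: "case_prod (tbs_dist N) \<in> borel_measurable (borel \<Otimes>\<^sub>M borel)"
  unfolding tbs_dist_def by measurable

lemma tbs_dist_radius:
  "r \<ge> 0 \<Longrightarrow> tbs_dist N (sqrt (r\<^sup>2 + (height N)\<^sup>2)) \<theta> = sqrt (r\<^sup>2 + (center_dist N)\<^sup>2 - 2 * r * center_dist N * cos \<theta>)"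
  by (simp add: tbs_dist_def)

context uplink_model
begin

lemma center_dist_eq: "dist (tbs N) (stadium_center N) = center_dist N"
  by (simp add: center_dist_def)

text \<open>A function of the slant distance is blind to the angle, which contributes 2 pi; divided
  by the area of the stadium this gives the constant in \<open>f_ZA\<close>.\<close>

lemma nn_integral_AsD:
  assumes [measurable]: "G \<in> borel_measurable (borel :: real measure)"
  shows "(\<integral>\<^sup>+ x. G (abs_dist N x) \<partial>\<mu>\<^sub>A) =
    (\<integral>\<^sup>+ z. G z * ennreal (f_ZA N z) * indicator {height N..max_length N} z \<partial>lborel)"
proof -
  have R: "R\<^sub>2 N > 0" by (rule R2_pos)
  have h: "height N > 0" by (rule height_pos)
  have "(\<integral>\<^sup>+ x. G (abs_dist N x) \<partial>\<mu>\<^sub>A) =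
    (\<integral>\<^sup>+ x. G (abs_dist N x) * indicator (stadium N) x \<partial>lborel) / ennreal (pi * (R\<^sub>2 N)\<^sup>2)"
    unfolding \<mu>\<^sub>A_def AsD_uniform using R
    by (subst nn_integral_uniform_measure) (auto simp: stadium_def emeasure_disk)
  also have "(\<integral>\<^sup>+ x. G (abs_dist N x) * indicator (stadium N) x \<partial>lborel) =
    (\<integral>\<^sup>+ x. G (sqrt ((dist x (stadium_center N))\<^sup>2 + (height N)\<^sup>2)) * indicator {..R\<^sub>2 N} (dist x (stadium_center N)) \<partial>lborel)"
    by (intro nn_integral_cong) (auto simp: abs_dist_eq stadium_def dist_commute split: split_indicator)
  also have "\<dots> = (\<integral>\<^sup>+ r. (\<integral>\<^sup>+ \<theta>. ennreal r * (G (sqrt (r\<^sup>2 + (height N)\<^sup>2)) * indicator {..R\<^sub>2 N} r)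
      * indicator {-pi..pi} \<theta> \<partial>lborel) * indicator {0<..} r \<partial>lborel)"
    using nn_integral_two_centers[of "\<lambda>r q. G (sqrt (r\<^sup>2 + (height N)\<^sup>2)) * indicator {..R\<^sub>2 N} r" "tbs N" "stadium_center N"]
      center_dist_pos by (simp add: center_dist_eq[symmetric])
  also have "\<dots> = (\<integral>\<^sup>+ r. ennreal (2 * pi) * (ennreal r * G (sqrt (r\<^sup>2 + (height N)\<^sup>2)) * indicator {0..R\<^sub>2 N} r) \<partial>lborel)"
  proof (rule nn_integral_cong)
    fix r
    have "(\<integral>\<^sup>+ \<theta>. ennreal r * (G (sqrt (r\<^sup>2 + (height N)\<^sup>2)) * indicator {..R\<^sub>2 N} r) * indicator {-pi..pi} \<theta> \<partial>lborel)
      = ennreal r * (G (sqrt (r\<^sup>2 + (height N)\<^sup>2)) * indicator {..R\<^sub>2 N} r) * ennreal (2 * pi)"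
      by (subst nn_integral_cmult_indicator) simp_all
    then show "(\<integral>\<^sup>+ \<theta>. ennreal r * (G (sqrt (r\<^sup>2 + (height N)\<^sup>2)) * indicator {..R\<^sub>2 N} r) * indicator {-pi..pi} \<theta> \<partial>lborel) * indicator {0<..} r
      = ennreal (2 * pi) * (ennreal r * G (sqrt (r\<^sup>2 + (height N)\<^sup>2)) * indicator {0..R\<^sub>2 N} r)"
      by (cases "r > 0"; cases "r \<le> R\<^sub>2 N"; cases "r = 0") (simp_all add: mult_ac)
  qed
  also have "\<dots> = ennreal (2 * pi) * (\<integral>\<^sup>+ r. ennreal r * G (sqrt (r\<^sup>2 + (height N)\<^sup>2)) * indicator {0..R\<^sub>2 N} r \<partial>lborel)"
    by (rule nn_integral_cmult) measurable
  also have "\<dots> = ennreal (2 * pi) * (\<integral>\<^sup>+ z. ennreal z * G z * indicator {height N..max_length N} z \<partial>lborel)"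
    using R h by (subst nn_integral_radial_slant) (auto simp: max_length_def add.commute)
  also have "\<dots> / ennreal (pi * (R\<^sub>2 N)\<^sup>2) = (\<integral>\<^sup>+ z. G z * ennreal (f_ZA N z) * indicator {height N..max_length N} z \<partial>lborel)"
  proof -
    have "ennreal (2 * pi) * I / ennreal (pi * (R\<^sub>2 N)\<^sup>2) = ennreal (2 / (R\<^sub>2 N)\<^sup>2) * I" for I
    proof -
      have "ennreal (2 * pi) * I / ennreal (pi * (R\<^sub>2 N)\<^sup>2) = (ennreal (2 * pi) / ennreal (pi * (R\<^sub>2 N)\<^sup>2)) * I"
        by (simp add: divide_ennreal_def mult_ac)
      also have "ennreal (2 * pi) / ennreal (pi * (R\<^sub>2 N)\<^sup>2) = ennreal (2 / (R\<^sub>2 N)\<^sup>2)"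
        using R by (subst divide_ennreal) (auto simp: field_simps)
      finally show ?thesis .
    qed
    moreover have "ennreal (2 / (R\<^sub>2 N)\<^sup>2) * (\<integral>\<^sup>+ z. ennreal z * G z * indicator {height N..max_length N} z \<partial>lborel) =
      (\<integral>\<^sup>+ z. ennreal (2 / (R\<^sub>2 N)\<^sup>2) * (ennreal z * G z * indicator {height N..max_length N} z) \<partial>lborel)"
      by (rule nn_integral_cmult[symmetric]) measurable
    moreover have "\<dots> = (\<integral>\<^sup>+ z. G z * ennreal (f_ZA N z) * indicator {height N..max_length N} z \<partial>lborel)"
    proof (intro nn_integral_cong)
      fix z
      have "ennreal (f_ZA N z) = ennreal (2 / (R\<^sub>2 N)\<^sup>2) * ennreal z"
        by (subst ennreal_mult'[symmetric]) (simp_all add: f_ZA_def)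
      then show "ennreal (2 / (R\<^sub>2 N)\<^sup>2) * (ennreal z * G z * indicator {height N..max_length N} z) =
        G z * ennreal (f_ZA N z) * indicator {height N..max_length N} z"
        by (simp add: mult_ac)
    qed
    ultimately show ?thesis by simp
  qed
  finally show ?thesis .
qed

text \<open>Avoiding the stadium depends on the radius only and becomes the lower limit. Membership
  in the cell depends on the angle too and survives as an indicator on
  \<open>tbs_dist\<close>.\<close>

lemma nn_integral_TsUE:
  fixes L :: "real \<Rightarrow> real \<Rightarrow> ennreal"
  assumes Lm: "case_prod L \<in> borel_measurable (borel \<Otimes>\<^sub>M borel)"
  shows "(\<integral>\<^sup>+ y. L (abs_dist N y) (dist y (tbs N)) \<partial>\<mu>\<^sub>T) =
    ennreal (1 / (pi * ((R\<^sub>1 N)\<^sup>2 - (R\<^sub>2 N)\<^sup>2))) *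
    (\<integral>\<^sup>+ z. ennreal z * (\<integral>\<^sup>+ \<theta>. L z (tbs_dist N z \<theta>) * indicator {..R\<^sub>1 N} (tbs_dist N z \<theta>) * indicator {-pi..pi} \<theta> \<partial>lborel) *
      indicator {sqrt ((R\<^sub>2 N)\<^sup>2 + (height N)\<^sup>2)..sqrt ((R\<^sub>1 N + center_dist N)\<^sup>2 + (height N)\<^sup>2)} z \<partial>lborel)"
proof -
  define d where "d = center_dist N"
  have d: "d > 0" using center_dist_pos by (simp add: d_def)
  have R: "0 < R\<^sub>2 N" "R\<^sub>2 N < R\<^sub>1 N" using R2_pos stadium_in_cell d by (auto simp: d_def)
  have h: "height N > 0" by (rule height_pos)
  have [measurable (raw)]: "(\<lambda>x. L (f x) (g x)) \<in> borel_measurable M"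
    if "f \<in> borel_measurable M" "g \<in> borel_measurable M" for f g and M :: "'m measure"
    using measurable_compose[OF measurable_Pair[OF that] Lm] by simp
  have [measurable (raw)]: "(\<lambda>x. tbs_dist N (f x) (g x)) \<in> borel_measurable M"
    if "f \<in> borel_measurable M" "g \<in> borel_measurable M" for f g and M :: "'m measure"
    using measurable_compose[OF measurable_Pair[OF that] tbs_dist_measurable] by simp
  have sub: "stadium N \<subseteq> cell N"
  proof
    fix x assume "x \<in> stadium N"
    then show "x \<in> cell N"
      using dist_triangle[of "tbs N" x "stadium_center N"] stadium_in_cell
      by (simp add: stadium_def cell_def center_dist_def)
  qed
  have [measurable]: "stadium N \<in> sets borel" "cell N \<in> sets borel"
    by (simp_all add: stadium_def cell_def)
  have area: "emeasure lborel (cell N - stadium N) = ennreal (pi * ((R\<^sub>1 N)\<^sup>2 - (R\<^sub>2 N)\<^sup>2))"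
  proof -
    have "emeasure lborel (cell N - stadium N) = emeasure lborel (cell N) - emeasure lborel (stadium N)"
      using sub R by (intro emeasure_Diff) (auto simp: stadium_def emeasure_disk)
    also have "\<dots> = ennreal (pi * ((R\<^sub>1 N)\<^sup>2 - (R\<^sub>2 N)\<^sup>2))"
      using R by (simp add: cell_def stadium_def emeasure_disk ennreal_minus right_diff_distrib)
    finally show ?thesis .
  qed
  have area_pos: "pi * ((R\<^sub>1 N)\<^sup>2 - (R\<^sub>2 N)\<^sup>2) > 0"
    using R by (simp add: power_strict_mono)
  let ?q = "\<lambda>r \<theta>. sqrt (r\<^sup>2 + d\<^sup>2 - 2 * r * d * cos \<theta>)"
  define H where "H z = (\<integral>\<^sup>+ \<theta>. L z (tbs_dist N z \<theta>) * indicator {..R\<^sub>1 N} (tbs_dist N z \<theta>) * indicator {-pi..pi} \<theta> \<partial>lborel)" for z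
  have [measurable]: "H \<in> borel_measurable borel" unfolding H_def by measurable
  have "(\<integral>\<^sup>+ y. L (abs_dist N y) (dist y (tbs N)) \<partial>\<mu>\<^sub>T) =
    (\<integral>\<^sup>+ y. L (abs_dist N y) (dist y (tbs N)) * indicator (cell N - stadium N) y \<partial>lborel) / ennreal (pi * ((R\<^sub>1 N)\<^sup>2 - (R\<^sub>2 N)\<^sup>2))"
    unfolding \<mu>\<^sub>T_def TsUE_uniform by (subst nn_integral_uniform_measure) (auto simp: area)
  also have "(\<integral>\<^sup>+ y. L (abs_dist N y) (dist y (tbs N)) * indicator (cell N - stadium N) y \<partial>lborel) =
    (\<integral>\<^sup>+ y. L (sqrt ((dist y (stadium_center N))\<^sup>2 + (height N)\<^sup>2)) (dist y (tbs N)) *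
       indicator {R\<^sub>2 N<..} (dist y (stadium_center N)) * indicator {..R\<^sub>1 N} (dist y (tbs N)) \<partial>lborel)"
    by (intro nn_integral_cong) (auto simp: abs_dist_eq stadium_def cell_def dist_commute split: split_indicator)
  also have "\<dots> = (\<integral>\<^sup>+ r. (\<integral>\<^sup>+ \<theta>. ennreal r * (L (sqrt (r\<^sup>2 + (height N)\<^sup>2)) (?q r \<theta>) * indicator {R\<^sub>2 N<..} r * indicator {..R\<^sub>1 N} (?q r \<theta>))
      * indicator {-pi..pi} \<theta> \<partial>lborel) * indicator {0<..} r \<partial>lborel)"
    using nn_integral_two_centers[of "\<lambda>r q. L (sqrt (r\<^sup>2 + (height N)\<^sup>2)) q * indicator {R\<^sub>2 N<..} r * indicator {..R\<^sub>1 N} q" "tbs N" "stadium_center N"]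
      center_dist_pos by (simp add: center_dist_eq[symmetric] d_def)
  also have "\<dots> = (\<integral>\<^sup>+ r. ennreal r * H (sqrt (r\<^sup>2 + (height N)\<^sup>2)) * indicator {R\<^sub>2 N..R\<^sub>1 N + d} r \<partial>lborel)"
  proof (rule nn_integral_cong_AE, use AE_lborel_singleton[of "R\<^sub>2 N"] in eventually_elim)
    fix r assume r: "r \<noteq> R\<^sub>2 N"
    show "(\<integral>\<^sup>+ \<theta>. ennreal r * (L (sqrt (r\<^sup>2 + (height N)\<^sup>2)) (?q r \<theta>) * indicator {R\<^sub>2 N<..} r * indicator {..R\<^sub>1 N} (?q r \<theta>))
      * indicator {-pi..pi} \<theta> \<partial>lborel) * indicator {0<..} r = ennreal r * H (sqrt (r\<^sup>2 + (height N)\<^sup>2)) * indicator {R\<^sub>2 N..R\<^sub>1 N + d} r"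
    proof (cases "r > R\<^sub>2 N")
      case False
      then show ?thesis using r by simp
    next
      case True
      then have r0: "r > 0" using R by simp
      have q: "tbs_dist N (sqrt (r\<^sup>2 + (height N)\<^sup>2)) \<theta> = ?q r \<theta>" for \<theta>
        using r0 by (simp add: tbs_dist_radius d_def)
      have "(\<integral>\<^sup>+ \<theta>. ennreal r * (L (sqrt (r\<^sup>2 + (height N)\<^sup>2)) (?q r \<theta>) * indicator {R\<^sub>2 N<..} r * indicator {..R\<^sub>1 N} (?q r \<theta>))
          * indicator {-pi..pi} \<theta> \<partial>lborel) = (\<integral>\<^sup>+ \<theta>. ennreal r * (L (sqrt (r\<^sup>2 + (height N)\<^sup>2)) (?q r \<theta>) * indicator {..R\<^sub>1 N} (?q r \<theta>) * indicator {-pi..pi} \<theta>) \<partial>lborel)"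
        using True by (intro nn_integral_cong) (simp add: mult_ac)
      also have "\<dots> = ennreal r * H (sqrt (r\<^sup>2 + (height N)\<^sup>2))"
        unfolding H_def q by (rule nn_integral_cmult) measurable
      finally have *: "(\<integral>\<^sup>+ \<theta>. ennreal r * (L (sqrt (r\<^sup>2 + (height N)\<^sup>2)) (?q r \<theta>) * indicator {R\<^sub>2 N<..} r * indicator {..R\<^sub>1 N} (?q r \<theta>))
          * indicator {-pi..pi} \<theta> \<partial>lborel) = ennreal r * H (sqrt (r\<^sup>2 + (height N)\<^sup>2))" .
      show ?thesis
      proof (cases "r \<le> R\<^sub>1 N + d")
        case True
        with * r0 \<open>r > R\<^sub>2 N\<close> show ?thesis by simp
      next
        case False
        \<comment> \<open>The reverse triangle inequality: such a point is at distance at least r -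
          d > R_1 from the TBS.\<close>
        have "?q r \<theta> > R\<^sub>1 N" for \<theta>
        proof (rule real_less_rsqrt)
          have "(R\<^sub>1 N)\<^sup>2 < (r - d)\<^sup>2" using False R by (intro power_strict_mono) auto
          also have "\<dots> \<le> r\<^sup>2 + d\<^sup>2 - 2 * r * d * cos \<theta>"
            using mult_left_mono[of "cos \<theta>" 1 "2 * r * d"] r0 d by (simp add: power2_diff)
          finally show "(R\<^sub>1 N)\<^sup>2 < r\<^sup>2 + d\<^sup>2 - 2 * r * d * cos \<theta>" .
        qed
        then have "H (sqrt (r\<^sup>2 + (height N)\<^sup>2)) = 0"
          unfolding H_def q by (simp add: not_le)
        with * False show ?thesis by simp
      qed
    qed
  qed
  also have "\<dots> = (\<integral>\<^sup>+ z. ennreal z * H z * indicator {sqrt ((R\<^sub>2 N)\<^sup>2 + (height N)\<^sup>2)..sqrt ((R\<^sub>1 N + d)\<^sup>2 + (height N)\<^sup>2)} z \<partial>lborel)"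
    using R d h by (intro nn_integral_radial_slant) auto
  also have "\<dots> / ennreal (pi * ((R\<^sub>1 N)\<^sup>2 - (R\<^sub>2 N)\<^sup>2)) = ennreal (1 / (pi * ((R\<^sub>1 N)\<^sup>2 - (R\<^sub>2 N)\<^sup>2))) * \<dots>"
    using area_pos by (simp add: divide_ennreal_def inverse_ennreal mult.commute inverse_eq_divide)
  finally show ?thesis unfolding H_def d_def .
qed

end

section \<open>The Laplace transform of the interference\<close>

text \<open>\<open>f\<close> inherits measurability from \<open>g\<close> on the open interval, and
  the endpoints are null. Pointwise finiteness is required because \<open>enn2real\<close> sends
  infinity to 0; an infinite total is harmless, both sides then being 0.\<close>

lemma interval_integral_eq_enn2real:
  fixes a b :: real
  assumes [measurable]: "g \<in> borel_measurable borel" and "a \<le> b"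
    and f: "\<And>x. a < x \<Longrightarrow> x < b \<Longrightarrow> f x = enn2real (g x)"
    and fin: "\<And>x. a < x \<Longrightarrow> x < b \<Longrightarrow> g x < \<infinity>"
  shows "(LBINT x=ereal a..ereal b. f x) = enn2real (\<integral>\<^sup>+ x. g x * indicator {a..b} x \<partial>lborel)"
proof -
  have "(LBINT x=ereal a..ereal b. f x) = (\<integral>x. enn2real (g x * indicator {a<..<b} x) \<partial>lborel)"
    using \<open>a \<le> b\<close> unfolding interval_lebesgue_integral_def set_lebesgue_integral_def
    by (auto intro!: Bochner_Integration.integral_cong simp: f split: split_indicator)
  also have "\<dots> = enn2real (\<integral>\<^sup>+ x. ennreal (enn2real (g x * indicator {a<..<b} x)) \<partial>lborel)"
    by (rule integral_eq_nn_integral) auto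
  also have "(\<integral>\<^sup>+ x. ennreal (enn2real (g x * indicator {a<..<b} x)) \<partial>lborel) = (\<integral>\<^sup>+ x. g x * indicator {a..b} x \<partial>lborel)"
  proof (rule nn_integral_cong_AE, use AE_lborel_singleton[of a] AE_lborel_singleton[of b] in eventually_elim)
    fix x assume "x \<noteq> a" "x \<noteq> b"
    then show "ennreal (enn2real (g x * indicator {a<..<b} x)) = g x * indicator {a..b} x"
      using fin[of x] by (cases "a < x \<and> x < b") (auto split: split_indicator)
  qed
  finally show ?thesis .
qed

lemma nn_integral_split_Icc:
  fixes a b c :: real
  assumes [measurable]: "g \<in> borel_measurable borel" and "a \<le> b" "b \<le> c"
  shows "(\<integral>\<^sup>+ x. g x * indicator {a..c} x \<partial>lborel) =
    (\<integral>\<^sup>+ x. g x * indicator {a..b} x \<partial>lborel) + (\<integral>\<^sup>+ x. g x * indicator {b..c} x \<partial>lborel)"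
proof -
  have "(\<integral>\<^sup>+ x. g x * indicator {a..c} x \<partial>lborel) = (\<integral>\<^sup>+ x. g x * indicator {a..b} x + g x * indicator {b..c} x \<partial>lborel)"
    by (rule nn_integral_cong_AE, use AE_lborel_singleton[of b] in eventually_elim)
      (use assms in \<open>auto split: split_indicator\<close>)
  then show ?thesis by (simp add: nn_integral_add)
qed

context uplink_model
begin

text \<open>Below the altitude \<open>p\<^sub>L\<close> is unconstrained, so the measurable function
  on the line is the one cut off there.\<close>

lemma link_prob_measurable_line [measurable]:
  "(\<lambda>z. indicator {height N..} z * link_prob N k z) \<in> borel_measurable borel"
proof -
  have L: "(\<lambda>z. indicator {height N..} z * p\<^sub>L N z) \<in> borel_measurable borel"
    using p_L_measurable by (simp add: borel_measurable_restrict_space_iff)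
  show ?thesis
  proof (cases k)
    case LOS
    then show ?thesis using L by (simp add: link_prob_def)
  next
    case NLOS
    have "(\<lambda>z. indicator {height N..} z - indicator {height N..} z * p\<^sub>L N z) \<in> borel_measurable borel"
      using L by (intro borel_measurable_diff) auto
    then show ?thesis using NLOS by (simp add: link_prob_def right_diff_distrib)
  qed
qed

text \<open>\<open>station_laplace\<close> as a function of the two distances instead of the
  position, the form that \<open>nn_integral_TsUE\<close> accepts. The indicator secures
  measurability in z.\<close>

definition link_laplace :: "real \<Rightarrow> real \<Rightarrow> real \<Rightarrow> real" where
  "link_laplace s z q = (\<Sum>k\<in>{LOS, NLOS}. indicator {height N..} z * link_prob N k z *
     (real (m\<^sub>a N k) / (real (m\<^sub>a N k) + s * (\<rho>\<^sub>T N * q powr \<alpha>\<^sub>T N) * path_loss N k z)) ^ m\<^sub>a N k)"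

lemma link_laplace_measurable: "case_prod (\<lambda>z q. ennreal (link_laplace s z q)) \<in> borel_measurable (borel \<Otimes>\<^sub>M borel)"
proof -
  have "(\<lambda>p::real \<times> real. indicator {height N..} (fst p) * link_prob N k (fst p)) \<in> borel_measurable (borel \<Otimes>\<^sub>M borel)" for k
    by (rule measurable_compose[OF measurable_fst link_prob_measurable_line])
  then show ?thesis
    unfolding link_laplace_def path_loss_def case_prod_beta' by measurable
qed

text \<open>From the altitude upwards this is a convex combination of numbers in [0, 1]. The upper
  bound supplies the finiteness needed to return to real integrals.\<close>

lemma link_laplace_bounds:
  assumes "s \<ge> 0"
  shows "0 \<le> link_laplace s z q" "link_laplace s z q \<le> 1"
proof -
  define b where "b k = (real (m\<^sub>a N k) / (real (m\<^sub>a N k) + s * (\<rho>\<^sub>T N * q powr \<alpha>\<^sub>T N) * path_loss N k z)) ^ m\<^sub>a N k" for k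
  have "0 \<le> s * (\<rho>\<^sub>T N * q powr \<alpha>\<^sub>T N) * path_loss N k z" for k
    using assms rho_T_pos eta_pos by (simp add: path_loss_def less_imp_le)
  then have b: "0 \<le> b k" "b k \<le> 1" for k
    using m_pos[of k] by (auto simp: b_def divide_le_eq add_pos_nonneg intro!: power_le_one)
  show "0 \<le> link_laplace s z q"
    unfolding link_laplace_def b_def[symmetric] using b
    by (auto intro!: add_nonneg_nonneg mult_nonneg_nonneg simp: link_prob_nonneg split: split_indicator)
  show "link_laplace s z q \<le> 1"
  proof (cases "z \<ge> height N")
    case True
    have "link_laplace s z q = link_prob N LOS z * b LOS + link_prob N NLOS z * b NLOS"
      using True by (simp add: link_laplace_def b_def)
    also have "\<dots> \<le> link_prob N LOS z * 1 + link_prob N NLOS z * 1"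
      using True b by (intro add_mono mult_left_mono) (auto simp: link_prob_nonneg)
    finally show ?thesis using link_prob_sum[of z] by simp
  qed (simp add: link_laplace_def)
qed

lemma station_laplace_eq: "station_laplace s y = link_laplace s (abs_dist N y) (dist y (tbs N))"
  by (simp add: station_laplace_def link_laplace_def P_TsUE_def height_le_abs_dist)

text \<open>With ground radius r, cos \<theta> \<le> 1 bounds the radicand below by (r - d)^2.
  Nonnegativity lets a power of the square root be read as half that power of the radicand.\<close>

lemma tbs_dist_sq_nonneg:
  "0 \<le> z\<^sup>2 - (height N)\<^sup>2 + (center_dist N)\<^sup>2 - 2 * sqrt (z\<^sup>2 - (height N)\<^sup>2) * center_dist N * cos \<theta>"
  if "z \<ge> height N"
proof -
  define r where "r = sqrt (z\<^sup>2 - (height N)\<^sup>2)"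
  have r: "r \<ge> 0" "z\<^sup>2 - (height N)\<^sup>2 = r\<^sup>2"
    using that height_pos by (simp_all add: r_def power_mono)
  have "0 \<le> (r - center_dist N)\<^sup>2" by simp
  also have "\<dots> \<le> r\<^sup>2 + (center_dist N)\<^sup>2 - 2 * r * center_dist N * cos \<theta>"
    using mult_left_mono[of "cos \<theta>" 1 "2 * r * center_dist N"] r center_dist_pos by (simp add: power2_diff)
  finally show ?thesis using r by (simp add: r_def[symmetric])
qed

lemma cond_laplace_eq:
  assumes "z \<ge> height N"
  shows "cond_laplace N s \<theta> z = link_laplace s z (tbs_dist N z \<theta>)"
proof -
  have "tbs_dist N z \<theta> powr \<alpha>\<^sub>T N = (z\<^sup>2 - (height N)\<^sup>2 + (center_dist N)\<^sup>2
      - 2 * sqrt (z\<^sup>2 - (height N)\<^sup>2) * center_dist N * cos \<theta>) powr (\<alpha>\<^sub>T N / 2)"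
    unfolding tbs_dist_def powr_half_sqrt[OF tbs_dist_sq_nonneg[OF assms], symmetric] powr_powr by simp
  note q = this
  have m: "a * b ^ n * c powi (- int n) = a * (b / c) ^ n" for a b c :: real and n
    by (simp add: power_int_minus power_divide inverse_eq_divide)
  show ?thesis
    using assms unfolding cond_laplace_def link_laplace_def path_loss_def q m
    by (intro sum.cong refl) (simp only: indicator_simps atLeast_iff mult_1 mult.assoc mult.commute mult.left_commute)
qed

text \<open>Both sides integrate one function \<open>g\<close> over the slant lengths. The split is
  where circles around the stadium centre stop lying inside the cell; farther out only an arc of
  half-angle \<open>omega_hat\<close> remains.\<close>

lemma laplace_eq:
  assumes s: "s > 0"
  shows "laplace N s = (\<integral>i. exp (- (s * i)) \<partial>J)"
proof -
  interpret J: prob_space J by (rule J)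
  note [measurable_cong] = J(2)
  define h d where "h = height N" and "d = center_dist N"
  \<comment> \<open>Slant lengths at the edge of the stadium, at the largest concentric circle
    inside the cell, and at the farthest point of the cell.\<close>
  define z1 z2 z3 where "z1 = sqrt ((R\<^sub>2 N)\<^sup>2 + h\<^sup>2)" and "z2 = sqrt ((R\<^sub>1 N - d)\<^sup>2 + h\<^sup>2)" and "z3 = sqrt ((R\<^sub>1 N + d)\<^sup>2 + h\<^sup>2)"
  define K where "K = 1 / (pi * ((R\<^sub>1 N)\<^sup>2 - (R\<^sub>2 N)\<^sup>2))"
  have d: "d > 0" using center_dist_pos by (simp add: d_def)
  have R: "0 < R\<^sub>2 N" "R\<^sub>2 N < R\<^sub>1 N" "R\<^sub>2 N \<le> R\<^sub>1 N - d" using R2_pos stadium_in_cell d by (auto simp: d_def)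
  have h: "h > 0" using height_pos by (simp add: h_def)
  have K: "K > 0" using R by (simp add: K_def power_strict_mono)
  have z: "h \<le> z1" "z1 \<le> z2" "z2 \<le> z3"
    using R d h by (auto simp: z1_def z2_def z3_def intro!: real_le_rsqrt power_mono)
  define L where "L z q = ennreal (link_laplace s z q)" for z q
  have Lm: "case_prod L \<in> borel_measurable (borel \<Otimes>\<^sub>M borel)"
    unfolding L_def by (rule link_laplace_measurable)
  have [measurable (raw)]: "(\<lambda>x. L (f x) (g x)) \<in> borel_measurable M"
    if "f \<in> borel_measurable M" "g \<in> borel_measurable M" for f g and M :: "'m measure"
    using measurable_compose[OF measurable_Pair[OF that] Lm] by simp
  have [measurable (raw)]: "(\<lambda>x. tbs_dist N (f x) (g x)) \<in> borel_measurable M"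
    if "f \<in> borel_measurable M" "g \<in> borel_measurable M" for f g and M :: "'m measure"
    using measurable_compose[OF measurable_Pair[OF that] tbs_dist_measurable] by simp
  define H where "H z = (\<integral>\<^sup>+ \<theta>. L z (tbs_dist N z \<theta>) * indicator {..R\<^sub>1 N} (tbs_dist N z \<theta>) * indicator {-pi..pi} \<theta> \<partial>lborel)" for z
  have Hm[measurable]: "H \<in> borel_measurable borel" unfolding H_def by measurable
  define g where "g z = ennreal (K * z) * H z" for z
  have gm[measurable]: "g \<in> borel_measurable borel" unfolding g_def by measurable
  have L_le: "L z q \<le> 1" for z q
    using link_laplace_bounds[of s z q] s by (simp add: L_def ennreal_le_1)
  have g_fin: "g z < \<infinity>" for z
  proof -
    have "H z \<le> (\<integral>\<^sup>+ \<theta>. 1 * indicator {-pi..pi} \<theta> \<partial>lborel)"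
      unfolding H_def by (intro nn_integral_mono) (auto simp: L_le split: split_indicator)
    also have "\<dots> < \<infinity>" by simp
    finally show ?thesis by (simp add: g_def ennreal_mult_less_top)
  qed
  have total: "(\<integral>\<^sup>+ i. ennreal (exp (- (s * i))) \<partial>J) = (\<integral>\<^sup>+ z. g z * indicator {z1..z3} z \<partial>lborel)"
  proof -
    have "(\<integral>\<^sup>+ i. ennreal (exp (- (s * i))) \<partial>J) = (\<integral>\<^sup>+ y. L (abs_dist N y) (dist y (tbs N)) \<partial>\<mu>\<^sub>T)"
      using s by (simp add: nn_integral_exp_J station_laplace_eq L_def)
    also have "\<dots> = ennreal K * (\<integral>\<^sup>+ z. ennreal z * H z * indicator {z1..z3} z \<partial>lborel)"
      unfolding nn_integral_TsUE[OF Lm] K_def H_def z1_def z3_def h_def d_def ..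
    also have "\<dots> = (\<integral>\<^sup>+ z. ennreal K * (ennreal z * H z * indicator {z1..z3} z) \<partial>lborel)"
      by (rule nn_integral_cmult[symmetric]) measurable
    also have "\<dots> = (\<integral>\<^sup>+ z. g z * indicator {z1..z3} z \<partial>lborel)"
      using K by (intro nn_integral_cong) (simp only: g_def ennreal_mult'[OF less_imp_le] mult.assoc)
    finally show ?thesis .
  qed
  have radius: "\<exists>r. r > 0 \<and> z = sqrt (r\<^sup>2 + h\<^sup>2) \<and> (\<forall>\<theta>. tbs_dist N z \<theta> = sqrt (r\<^sup>2 + d\<^sup>2 - 2 * r * d * cos \<theta>)) \<and>
      sqrt (z\<^sup>2 - h\<^sup>2) = r \<and> z\<^sup>2 - h\<^sup>2 = r\<^sup>2" if "z > z1" for z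
  proof -
    have "z\<^sup>2 > z1\<^sup>2" using that z h by (intro power_strict_mono) auto
    then have "(R\<^sub>2 N)\<^sup>2 + h\<^sup>2 < z\<^sup>2"
      by (simp add: z1_def)
    then have *: "z\<^sup>2 - h\<^sup>2 > 0"
      using zero_less_power[OF R(1), of 2] by linarith
    define r where "r = sqrt (z\<^sup>2 - h\<^sup>2)"
    have r: "r > 0" "z\<^sup>2 - h\<^sup>2 = r\<^sup>2" "sqrt (z\<^sup>2 - h\<^sup>2) = r" using * by (simp_all add: r_def)
    have "z = sqrt (r\<^sup>2 + h\<^sup>2)" using that z h by (simp add: r(2)[symmetric])
    moreover have "tbs_dist N z \<theta> = sqrt (r\<^sup>2 + d\<^sup>2 - 2 * r * d * cos \<theta>)" for \<theta>
      unfolding tbs_dist_def h_def[symmetric] d_def[symmetric] r(2) using r(1) by simp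
    ultimately show ?thesis using r by blast
  qed
  \<comment> \<open>In the outer range the angle in \<open>f_ZT\<close> cancels against that in
    \<open>f_Omega\<close>, so both ranges have the joint density K z. The cancellation needs a
    nonzero angle, which is given wherever the interval of angles has interior.\<close>
  have density: "cond_laplace N s \<theta> z * f_Omega N \<theta> z * f_ZT N z = enn2real (ennreal (K * z) * L z (tbs_dist N z \<theta>))"
    if "z > z1" "z \<le> z2 \<or> omega_hat N z > 0" for z \<theta>
  proof -
    have "f_Omega N \<theta> z * f_ZT N z = K * z"
      using that R by (auto simp: f_Omega_def f_ZT_def K_def z2_def h_def[symmetric] d_def[symmetric] field_simps)
    moreover have "cond_laplace N s \<theta> z = link_laplace s z (tbs_dist N z \<theta>)"
      using that z by (intro cond_laplace_eq) (simp add: h_def[symmetric])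
    ultimately show ?thesis
      using link_laplace_bounds[of s z] s K that z h
      by (simp add: L_def enn2real_mult mult_ac)
  qed
  have inner_fin: "ennreal (K * z) * L z q < \<infinity>" for z q
    by (simp add: ennreal_mult_less_top L_def)
  have I1: "(LBINT \<theta> = 0 .. 2 * pi. cond_laplace N s \<theta> z * f_Omega N \<theta> z * f_ZT N z) = enn2real (g z)"
    if zz: "z1 < z" "z < z2" for z
  proof -
    obtain r where r: "r > 0" "z = sqrt (r\<^sup>2 + h\<^sup>2)" "\<And>\<theta>. tbs_dist N z \<theta> = sqrt (r\<^sup>2 + d\<^sup>2 - 2 * r * d * cos \<theta>)"
      using radius[OF zz(1)] by blast
    have "r\<^sup>2 < (R\<^sub>1 N - d)\<^sup>2" using that(2) by (simp add: r(2) z2_def)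
    then have "r < R\<^sub>1 N - d" using R by (auto intro: power2_less_imp_less)
    have near: "tbs_dist N z \<theta> \<le> R\<^sub>1 N" for \<theta>
      unfolding r(3)
    proof (rule real_le_lsqrt)
      have "r\<^sup>2 + d\<^sup>2 - 2 * r * d * cos \<theta> \<le> (r + d)\<^sup>2"
        using mult_left_mono[of "-1" "cos \<theta>" "2 * r * d"] r d by (simp add: power2_sum)
      also have "\<dots> \<le> (R\<^sub>1 N)\<^sup>2" using \<open>r < R\<^sub>1 N - d\<close> r d by (intro power_mono) auto
      finally show "r\<^sup>2 + d\<^sup>2 - 2 * r * d * cos \<theta> \<le> (R\<^sub>1 N)\<^sup>2" .
    qed (use R in auto)
    have "(LBINT \<theta> = ereal 0 .. ereal (2 * pi). cond_laplace N s \<theta> z * f_Omega N \<theta> z * f_ZT N z) =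
      enn2real (\<integral>\<^sup>+ \<theta>. ennreal (K * z) * L z (tbs_dist N z \<theta>) * indicator {0..2*pi} \<theta> \<partial>lborel)"
      using that by (intro interval_integral_eq_enn2real density inner_fin) auto
    also have "(\<integral>\<^sup>+ \<theta>. ennreal (K * z) * L z (tbs_dist N z \<theta>) * indicator {0..2*pi} \<theta> \<partial>lborel) =
      (\<integral>\<^sup>+ \<theta>. ennreal (K * z) * L z (tbs_dist N z \<theta>) * indicator {-pi..pi} \<theta> \<partial>lborel)"
      using nn_integral_periodic_shift[of "\<lambda>\<theta>. ennreal (K * z) * L z (tbs_dist N z \<theta>)" "2 * pi" 0 "-pi"]
      by (simp add: tbs_dist_def)
    also have "\<dots> = (\<integral>\<^sup>+ \<theta>. ennreal (K * z) * (L z (tbs_dist N z \<theta>) * indicator {..R\<^sub>1 N} (tbs_dist N z \<theta>) * indicator {-pi..pi} \<theta>) \<partial>lborel)"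
      by (simp add: near mult_ac)
    also have "\<dots> = g z"
      unfolding g_def H_def by (rule nn_integral_cmult) measurable
    finally show ?thesis by (simp add: zero_ereal_def)
  qed
  have I2: "(LBINT \<theta> = - omega_hat N z .. omega_hat N z. cond_laplace N s \<theta> z * f_Omega N \<theta> z * f_ZT N z) = enn2real (g z)"
    if "z2 < z" "z < z3" for z
  proof -
    have "z1 < z" using that z by simp
    then obtain r where r: "r > 0" "z = sqrt (r\<^sup>2 + h\<^sup>2)" "\<And>\<theta>. tbs_dist N z \<theta> = sqrt (r\<^sup>2 + d\<^sup>2 - 2 * r * d * cos \<theta>)"
      "sqrt (z\<^sup>2 - h\<^sup>2) = r" "z\<^sup>2 - h\<^sup>2 = r\<^sup>2"
      using radius by blast
    \<comment> \<open>By the law of cosines, the cosine of the angle at which the circle of radius r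
      meets the boundary of the cell.\<close>
    define c where "c = (d\<^sup>2 + r\<^sup>2 - (R\<^sub>1 N)\<^sup>2) / (2 * d * r)"
    \<comment> \<open>Division by zero is consistent: if d^2 + r^2 = R_1^2, the reciprocal in
      \<open>arcsec\<close> and \<open>c\<close> are both 0.\<close>
    have \<omega>: "omega_hat N z = arccos c"
    proof -
      have e: "d\<^sup>2 + z\<^sup>2 - h\<^sup>2 = d\<^sup>2 + r\<^sup>2" using r(5) by linarith
      show ?thesis
        unfolding omega_hat_def arcsec_def c_def h_def[symmetric] d_def[symmetric] r(4) e by simp
    qed
    have "(R\<^sub>1 N - d)\<^sup>2 < r\<^sup>2" "r\<^sup>2 < (R\<^sub>1 N + d)\<^sup>2" using that by (simp_all add: r(2) z2_def z3_def)
    then have rb: "R\<^sub>1 N - d < r" "r < R\<^sub>1 N + d" using r R d by (auto intro: power2_less_imp_less)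
    \<comment> \<open>The triangle inequalities between r, d and R_1 put \<open>c\<close> into
      [- 1, 1], where arccos is decreasing.\<close>
    have "(r - d)\<^sup>2 \<le> (R\<^sub>1 N)\<^sup>2" "(R\<^sub>1 N)\<^sup>2 \<le> (r + d)\<^sup>2"
      using rb r R d by (auto simp: abs_le_square_iff[symmetric])
    then have "- (2 * d * r) \<le> d\<^sup>2 + r\<^sup>2 - (R\<^sub>1 N)\<^sup>2" "d\<^sup>2 + r\<^sup>2 - (R\<^sub>1 N)\<^sup>2 \<le> 2 * d * r"
      by (simp_all add: power2_sum power2_diff mult.assoc mult.commute[of r d])
    then have c: "-1 \<le> c" "c \<le> 1"
      using r(1) d by (simp_all add: c_def le_divide_eq divide_le_eq)
    have o: "0 \<le> omega_hat N z" "omega_hat N z \<le> pi"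
      using c by (simp_all add: \<omega> arccos_lbound arccos_ubound)
    have near: "tbs_dist N z \<theta> \<le> R\<^sub>1 N \<longleftrightarrow> \<theta> \<in> {- omega_hat N z..omega_hat N z}" if "\<theta> \<in> {-pi..pi}" for \<theta>
    proof -
      have "tbs_dist N z \<theta> \<le> R\<^sub>1 N \<longleftrightarrow> r\<^sup>2 + d\<^sup>2 - 2 * r * d * cos \<theta> \<le> (R\<^sub>1 N)\<^sup>2"
        unfolding r(3) using R real_sqrt_le_iff[of "r\<^sup>2 + d\<^sup>2 - 2 * r * d * cos \<theta>" "(R\<^sub>1 N)\<^sup>2"] by simp
      also have "\<dots> \<longleftrightarrow> c \<le> cos \<theta>"
        using r(1) d by (auto simp: c_def divide_le_eq algebra_simps)
      \<comment> \<open>The absolute value keeps the cosine and brings the angle into [0, pi], where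
        arccos inverts it.\<close>
      also have "\<dots> \<longleftrightarrow> arccos (cos \<bar>\<theta>\<bar>) \<le> arccos c"
        using c by (subst arccos_le_mono) auto
      also have "arccos (cos \<bar>\<theta>\<bar>) = \<bar>\<theta>\<bar>"
        using that by (intro arccos_cos) auto
      finally show ?thesis by (auto simp: \<omega>)
    qed
    have "(LBINT \<theta> = ereal (- omega_hat N z) .. ereal (omega_hat N z). cond_laplace N s \<theta> z * f_Omega N \<theta> z * f_ZT N z) =
      enn2real (\<integral>\<^sup>+ \<theta>. ennreal (K * z) * L z (tbs_dist N z \<theta>) * indicator {- omega_hat N z..omega_hat N z} \<theta> \<partial>lborel)"
      using \<open>z1 < z\<close> o by (intro interval_integral_eq_enn2real density inner_fin) auto
    also have "(\<integral>\<^sup>+ \<theta>. ennreal (K * z) * L z (tbs_dist N z \<theta>) * indicator {- omega_hat N z..omega_hat N z} \<theta> \<partial>lborel) =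
      (\<integral>\<^sup>+ \<theta>. ennreal (K * z) * (L z (tbs_dist N z \<theta>) * indicator {..R\<^sub>1 N} (tbs_dist N z \<theta>) * indicator {-pi..pi} \<theta>) \<partial>lborel)"
    proof (rule nn_integral_cong)
      fix \<theta>
      show "ennreal (K * z) * L z (tbs_dist N z \<theta>) * indicator {- omega_hat N z..omega_hat N z} \<theta> =
        ennreal (K * z) * (L z (tbs_dist N z \<theta>) * indicator {..R\<^sub>1 N} (tbs_dist N z \<theta>) * indicator {-pi..pi} \<theta>)"
        using near[of \<theta>] o by (cases "\<theta> \<in> {-pi..pi}") (auto simp: mult_ac split: split_indicator)
    qed
    also have "\<dots> = g z"
      unfolding g_def H_def by (rule nn_integral_cmult) measurable
    finally show ?thesis by simp
  qed
  have "laplace N s = (LBINT z = ereal z1 .. ereal z2. (LBINT \<theta> = 0 .. 2 * pi. cond_laplace N s \<theta> z * f_Omega N \<theta> z * f_ZT N z)) +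
    (LBINT z = ereal z2 .. ereal z3. (LBINT \<theta> = - omega_hat N z .. omega_hat N z. cond_laplace N s \<theta> z * f_Omega N \<theta> z * f_ZT N z))"
    unfolding laplace_def z1_def z2_def z3_def h_def d_def ..
  also have "(LBINT z = ereal z1 .. ereal z2. (LBINT \<theta> = 0 .. 2 * pi. cond_laplace N s \<theta> z * f_Omega N \<theta> z * f_ZT N z)) =
      enn2real (\<integral>\<^sup>+ z. g z * indicator {z1..z2} z \<partial>lborel)"
    by (rule interval_integral_eq_enn2real) (use z I1 g_fin in auto)
  also have "(LBINT z = ereal z2 .. ereal z3. (LBINT \<theta> = - omega_hat N z .. omega_hat N z. cond_laplace N s \<theta> z * f_Omega N \<theta> z * f_ZT N z)) =
      enn2real (\<integral>\<^sup>+ z. g z * indicator {z2..z3} z \<partial>lborel)"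
    by (rule interval_integral_eq_enn2real) (use z I2 g_fin in auto)
  also have "enn2real (\<integral>\<^sup>+ z. g z * indicator {z1..z2} z \<partial>lborel) + enn2real (\<integral>\<^sup>+ z. g z * indicator {z2..z3} z \<partial>lborel) =
    enn2real (\<integral>\<^sup>+ i. ennreal (exp (- (s * i))) \<partial>J)"
  proof -
    have "(\<integral>\<^sup>+ i. ennreal (exp (- (s * i))) \<partial>J) \<le> (\<integral>\<^sup>+ i. 1 \<partial>J)"
      by (rule nn_integral_mono_AE, use AE_J_nonneg in eventually_elim) (use s in \<open>simp add: ennreal_le_1\<close>)
    then have "(\<integral>\<^sup>+ i. ennreal (exp (- (s * i))) \<partial>J) < \<infinity>"
      by (simp add: J.emeasure_space_1 le_less_trans)
    moreover have "(\<integral>\<^sup>+ i. ennreal (exp (- (s * i))) \<partial>J) = (\<integral>\<^sup>+ z. g z * indicator {z1..z2} z \<partial>lborel) + (\<integral>\<^sup>+ z. g z * indicator {z2..z3} z \<partial>lborel)"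
      unfolding total by (rule nn_integral_split_Icc) (use z in auto)
    ultimately show ?thesis by (simp add: enn2real_plus)
  qed
  also have "\<dots> = (\<integral>i. exp (- (s * i)) \<partial>J)"
    by (rule integral_eq_nn_integral[symmetric]) auto
  finally show ?thesis .
qed

end

section \<open>The capped power control\<close>

context uplink_model
begin

text \<open>The power is \<open>P_AsD\<close> with its minimum, so that one density serves the
  capped and the uncapped regime.\<close>

definition coverage_density :: "real \<Rightarrow> link_state \<Rightarrow> real \<Rightarrow> ennreal" where
  "coverage_density \<gamma> k z = ennreal (indicator {height N..} z * link_prob N k z) *
    (\<integral>\<^sup>+ i. ennreal (poisson_tail (m\<^sub>a N k) (s_arg N \<gamma> k (P_AsD N k z) z * (i + noise_power N))) \<partial>J) *
    ennreal (f_ZA N z)"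

lemma coverage_kernel_measurable [measurable]:
  "(\<lambda>z. ennreal (indicator {height N..} z * link_prob N k z) *
    (\<integral>\<^sup>+ i. ennreal (poisson_tail (m\<^sub>a N k) (s_arg N \<gamma> k (P_AsD N k z) z * (i + noise_power N))) \<partial>J)) \<in> borel_measurable borel"
proof -
  interpret J: prob_space J by (rule J)
  note [measurable_cong] = J(2)
  show ?thesis by measurable
qed

lemma coverage_density_measurable [measurable]: "coverage_density \<gamma> k \<in> borel_measurable borel"
  unfolding coverage_density_def[abs_def] f_ZA_def by measurable

lemma cond_coverage_expectation:
  fixes \<gamma> z :: real and k :: link_state
  assumes "\<gamma> > 0" "z \<ge> height N"
  defines "tail \<equiv> \<lambda>i. poisson_tail (m\<^sub>a N k) (s_arg N \<gamma> k (P_AsD N k z) z * (i + noise_power N))"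
  shows "cond_coverage N \<gamma> k (P_AsD N k z) z = link_prob N k z * (\<integral>i. tail i \<partial>J)"
    and "integrable J tail" and "AE i in J. 0 \<le> tail i"
proof -
  have z: "z > 0" using assms height_pos by simp
  note s = s_arg_pos[OF assms(1) z P_AsD_pos[OF z], of k k]
  show "cond_coverage N \<gamma> k (P_AsD N k z) z = link_prob N k z * (\<integral>i. tail i \<partial>J)" "integrable J tail"
    unfolding tail_def
    by (rule cond_coverage_eq[OF _ assms(1) z P_AsD_pos[OF z]], erule laplace_eq)+
  show "AE i in J. 0 \<le> tail i"
    unfolding tail_def using AE_J_nonneg
    by eventually_elim (use s noise_pos in \<open>auto intro!: poisson_tail_nonneg mult_nonneg_nonneg simp: less_imp_le\<close>)
qed

lemma cond_coverage_f_ZA_nonneg: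
  assumes "\<gamma> > 0" "z \<ge> height N"
  shows "0 \<le> cond_coverage N \<gamma> k (P_AsD N k z) z * f_ZA N z"
  using assms height_pos link_prob_nonneg[of z k] integral_nonneg_AE[OF cond_coverage_expectation(3)[OF assms]]
  by (simp add: cond_coverage_expectation(1) f_ZA_def)

lemma coverage_density_eq:
  assumes "\<gamma> > 0" "z \<ge> height N"
  shows "coverage_density \<gamma> k z = ennreal (cond_coverage N \<gamma> k (P_AsD N k z) z * f_ZA N z)"
proof -
  have "0 \<le> f_ZA N z" using assms height_pos by (simp add: f_ZA_def)
  then show ?thesis
    using assms link_prob_nonneg[of z k] integral_nonneg_AE[OF cond_coverage_expectation(3)[OF assms]]
    by (simp add: coverage_density_def cond_coverage_expectation ennreal_mult[symmetric] nn_integral_eq_integral)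
qed

text \<open>The integrand contains iterated derivatives; its measurability is inherited from
  \<open>coverage_density\<close>, with which it agrees from the altitude upwards.\<close>

lemma interval_integral_cond_coverage:
  assumes "\<gamma> > 0" "height N \<le> a" "a \<le> b"
  shows "(LBINT z=ereal a..ereal b. cond_coverage N \<gamma> k (P_AsD N k z) z * f_ZA N z) =
    enn2real (\<integral>\<^sup>+ z. coverage_density \<gamma> k z * indicator {a..b} z \<partial>lborel)"
  by (rule interval_integral_eq_enn2real)
    (use assms in \<open>auto simp: coverage_density_eq cond_coverage_f_ZA_nonneg\<close>)

lemma height_le_max_length: "height N \<le> max_length N"
  unfolding max_length_def by (rule real_le_rsqrt) simp

lemma emeasure_coverage_density:
  assumes "\<gamma> > 0"
  shows "emeasure Pr {w \<in> space Pr. SINR N (X\<^sub>A w) (K\<^sub>A w) (G\<^sub>A w) (X\<^sub>T w) (K\<^sub>T w) (G\<^sub>T w) > \<gamma>} =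
    (\<Sum>k\<in>{LOS, NLOS}. \<integral>\<^sup>+ z. coverage_density \<gamma> k z * indicator {height N..max_length N} z \<partial>lborel)"
  unfolding emeasure_coverage[OF assms]
proof (rule sum.cong[OF refl])
  fix k
  show "(\<integral>\<^sup>+ x. ennreal (link_prob N k (abs_dist N x)) *
       (\<integral>\<^sup>+ i. ennreal (poisson_tail (m\<^sub>a N k) (s_arg N \<gamma> k (P_AsD N k (abs_dist N x)) (abs_dist N x) * (i + noise_power N))) \<partial>J) \<partial>\<mu>\<^sub>A) =
    (\<integral>\<^sup>+ z. coverage_density \<gamma> k z * indicator {height N..max_length N} z \<partial>lborel)"
    using nn_integral_AsD[OF coverage_kernel_measurable[of k \<gamma>]]
    by (simp add: height_le_abs_dist coverage_density_def)
qed

text \<open>The common form of \<open>A_int\<close> and \<open>B_int\<close> before the cap has been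
  located.\<close>

definition coverage_part :: "real \<Rightarrow> link_state \<Rightarrow> real \<Rightarrow> real \<Rightarrow> real" where
  "coverage_part \<gamma> k a b = (LBINT z=ereal a..ereal b. cond_coverage N \<gamma> k (P_AsD N k z) z * f_ZA N z)"

text \<open>Additivity of \<open>enn2real\<close> needs finite integrals; they are finite because
  together they amount to a probability.\<close>

lemma
  assumes \<gamma>: "\<gamma> > 0"
  shows prob_coverage: "prob {w \<in> space Pr. SINR N (X\<^sub>A w) (K\<^sub>A w) (G\<^sub>A w) (X\<^sub>T w) (K\<^sub>T w) (G\<^sub>T w) > \<gamma>} =
      coverage_part \<gamma> LOS (height N) (max_length N) + coverage_part \<gamma> NLOS (height N) (max_length N)"
    and coverage_part_split: "height N \<le> b \<Longrightarrow> b \<le> max_length N \<Longrightarrow>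
      coverage_part \<gamma> k (height N) (max_length N) = coverage_part \<gamma> k (height N) b + coverage_part \<gamma> k b (max_length N)"
proof -
  let ?I = "\<lambda>k a b. \<integral>\<^sup>+ z. coverage_density \<gamma> k z * indicator {a..b} z \<partial>lborel"
  have sum: "?I LOS (height N) (max_length N) + ?I NLOS (height N) (max_length N) =
    emeasure Pr {w \<in> space Pr. SINR N (X\<^sub>A w) (K\<^sub>A w) (G\<^sub>A w) (X\<^sub>T w) (K\<^sub>T w) (G\<^sub>T w) > \<gamma>}"
    by (simp add: emeasure_coverage_density[OF \<gamma>])
  then have "?I LOS (height N) (max_length N) + ?I NLOS (height N) (max_length N) < \<infinity>"
    by (simp add: emeasure_eq_measure)
  then have fin: "?I k (height N) (max_length N) < \<infinity>" for k
    by (cases k) auto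
  have part: "coverage_part \<gamma> k a b = enn2real (?I k a b)" if "height N \<le> a" "a \<le> b" for k a b
    unfolding coverage_part_def using \<gamma> that by (rule interval_integral_cond_coverage)
  show "prob {w \<in> space Pr. SINR N (X\<^sub>A w) (K\<^sub>A w) (G\<^sub>A w) (X\<^sub>T w) (K\<^sub>T w) (G\<^sub>T w) > \<gamma>} =
      coverage_part \<gamma> LOS (height N) (max_length N) + coverage_part \<gamma> NLOS (height N) (max_length N)"
    using fin by (simp add: measure_def sum[symmetric] part height_le_max_length enn2real_plus)
  show "coverage_part \<gamma> k (height N) (max_length N) = coverage_part \<gamma> k (height N) b + coverage_part \<gamma> k b (max_length N)"
    if b: "height N \<le> b" "b \<le> max_length N"
  proof -
    have "?I k (height N) (max_length N) = ?I k (height N) b + ?I k b (max_length N)"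
      using b by (intro nn_integral_split_Icc) auto
    then show ?thesis
      using fin[of k] b by (simp add: part height_le_max_length enn2real_plus)
  qed
qed

section \<open>The cap length relative to the range of link lengths\<close>

lemma D_lim_pos: "D_lim N k > 0"
  using P_M_pos eta_pos[of k] rho_A_pos by (simp add: D_lim_def)

lemma D_lim_powr: "D_lim N k powr \<alpha>\<^sub>a N k = P\<^sub>M N * \<eta>\<^sub>a N k / \<rho>\<^sub>A N"
  using P_M_pos eta_pos[of k] rho_A_pos alpha_pos[of k] by (simp add: D_lim_def powr_powr)

lemma P_AsD_below: "0 < z \<Longrightarrow> z \<le> D_lim N k \<Longrightarrow> P_AsD N k z = \<rho>\<^sub>A N / \<eta>\<^sub>a N k * z powr \<alpha>\<^sub>a N k"
  using powr_mono2[of "\<alpha>\<^sub>a N k" z "D_lim N k"] alpha_pos[of k] eta_pos[of k] rho_A_pos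
  by (simp add: P_AsD_def D_lim_powr min_def field_simps)

lemma P_AsD_above: "D_lim N k \<le> z \<Longrightarrow> P_AsD N k z = P\<^sub>M N"
  using powr_mono2[of "\<alpha>\<^sub>a N k" "D_lim N k" z] alpha_pos[of k] eta_pos[of k] rho_A_pos D_lim_pos[of k]
  by (simp add: P_AsD_def D_lim_powr min_def field_simps)

lemma coverage_part_A:
  assumes "height N \<le> a" "a \<le> b" "b \<le> D_lim N k"
  shows "coverage_part \<gamma> k a b = A_int N \<gamma> k a b"
  unfolding coverage_part_def A_int_def
  by (rule interval_integral_cong) (use assms height_pos in \<open>auto simp: P_AsD_below\<close>)

lemma coverage_part_B:
  assumes "D_lim N k \<le> a" "a \<le> b"
  shows "coverage_part \<gamma> k a b = B_int N \<gamma> k a b"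
  unfolding coverage_part_def B_int_def
  by (rule interval_integral_cong) (use assms in \<open>auto simp: P_AsD_above\<close>)

text \<open>Squared, the claim is D^2 - R_2^2 \<le> h^2. If D < R_2, where \<open>E_lim\<close> is 0
  by convention, it holds because R_2 \<le> M.\<close>

lemma D_lim_le_max_length:
  assumes "E_lim N k \<le> height N"
  shows "D_lim N k \<le> max_length N"
  unfolding max_length_def
proof (rule real_le_rsqrt)
  show "(D_lim N k)\<^sup>2 \<le> (height N)\<^sup>2 + (R\<^sub>2 N)\<^sup>2"
  proof (cases "D_lim N k < R\<^sub>2 N")
    case True
    then have "(D_lim N k)\<^sup>2 \<le> (R\<^sub>2 N)\<^sup>2" using D_lim_pos[of k] by (intro power_mono) auto
    then show ?thesis using zero_le_power2[of "height N"] by linarith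
  next
    case False
    then have "sqrt ((D_lim N k)\<^sup>2 - (R\<^sub>2 N)\<^sup>2) \<le> height N" using assms by (simp add: E_lim_def)
    from sqrt_le_D[OF this] show ?thesis by simp
  qed
qed

lemma max_length_le_D_lim:
  assumes "height N \<le> E_lim N k"
  shows "max_length N \<le> D_lim N k"
proof -
  \<comment> \<open>h > 0 excludes the conventional value 0 of \<open>E_lim\<close>.\<close>
  have D: "\<not> D_lim N k < R\<^sub>2 N" using assms height_pos by (auto simp: E_lim_def)
  then have "height N \<le> sqrt ((D_lim N k)\<^sup>2 - (R\<^sub>2 N)\<^sup>2)" using assms by (simp add: E_lim_def)
  then have "(height N)\<^sup>2 \<le> (sqrt ((D_lim N k)\<^sup>2 - (R\<^sub>2 N)\<^sup>2))\<^sup>2"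
    using height_pos by (intro power_mono) auto
  also have "\<dots> = (D_lim N k)\<^sup>2 - (R\<^sub>2 N)\<^sup>2"
    using D R2_pos by (simp add: power_mono)
  finally show ?thesis
    unfolding max_length_def using D_lim_pos[of k] by (intro real_le_lsqrt) auto
qed

text \<open>At length D_N the NLOS path loss equals rho_A / P_M. The LOS value there is larger, so
  the LOS link is not yet capped. The hypothesis places D_N where the two path losses are
  ordered.\<close>

lemma D_lim_less:
  assumes "height N \<le> D_lim N NLOS"
  shows "D_lim N NLOS < D_lim N LOS"
proof -
  let ?z = "D_lim N NLOS"
  have "\<eta>\<^sub>a N NLOS / ?z powr \<alpha>\<^sub>a N NLOS < \<eta>\<^sub>a N LOS / ?z powr \<alpha>\<^sub>a N LOS"
    using NLOS_attenuates_more[OF assms] by (simp add: path_loss_def powr_minus divide_inverse)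
  then have "\<rho>\<^sub>A N / P\<^sub>M N < \<eta>\<^sub>a N LOS / ?z powr \<alpha>\<^sub>a N LOS"
    using eta_pos[of NLOS] by (simp add: D_lim_powr)
  then have "?z powr \<alpha>\<^sub>a N LOS < D_lim N LOS powr \<alpha>\<^sub>a N LOS"
    unfolding D_lim_powr using P_M_pos rho_A_pos D_lim_pos[of NLOS] by (simp add: field_simps)
  then show ?thesis
    using powr_less_cancel2[OF alpha_pos[of LOS]] D_lim_pos by blast
qed

lemma coverage_part_capped:
  "D_lim N k \<le> height N \<Longrightarrow> coverage_part \<gamma> k (height N) (max_length N) = B_int N \<gamma> k (height N) (max_length N)"
  by (rule coverage_part_B) (auto simp: height_le_max_length)

lemma coverage_part_uncapped:
  "height N \<le> E_lim N k \<Longrightarrow> coverage_part \<gamma> k (height N) (max_length N) = A_int N \<gamma> k (height N) (max_length N)"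
  by (rule coverage_part_A) (auto simp: height_le_max_length max_length_le_D_lim)

lemma coverage_part_mixed:
  assumes "\<gamma> > 0" "height N \<le> D_lim N k" "D_lim N k \<le> max_length N"
  shows "coverage_part \<gamma> k (height N) (max_length N) =
    A_int N \<gamma> k (height N) (D_lim N k) + B_int N \<gamma> k (D_lim N k) (max_length N)"
  using assms by (simp add: coverage_part_split[of \<gamma> "D_lim N k"] coverage_part_A coverage_part_B)

end

theorem theorem2:
  fixes Pr :: "'w measure"
    and N :: uplink
    and X\<^sub>A X\<^sub>T :: "'w \<Rightarrow> real \<times> real"
    and K\<^sub>A K\<^sub>T :: "'w \<Rightarrow> link_state"
    and G\<^sub>A G\<^sub>T :: "'w \<Rightarrow> real"
    and \<gamma> :: real
  assumes "uplink_model Pr N X\<^sub>A X\<^sub>T K\<^sub>A K\<^sub>T G\<^sub>A G\<^sub>T"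
    and "\<gamma> > 0"
  shows
    "let cov = measure Pr {w \<in> space Pr. SINR N (X\<^sub>A w) (K\<^sub>A w) (G\<^sub>A w) (X\<^sub>T w) (K\<^sub>T w) (G\<^sub>T w) > \<gamma>};
         h = height N; M = max_length N;
         D\<^sub>L = D_lim N LOS; D\<^sub>N = D_lim N NLOS; E\<^sub>L = E_lim N LOS; E\<^sub>N = E_lim N NLOS;
         A\<^sub>L = A_int N \<gamma> LOS; A\<^sub>N = A_int N \<gamma> NLOS; B\<^sub>L = B_int N \<gamma> LOS; B\<^sub>N = B_int N \<gamma> NLOS
     in
       (h \<ge> D\<^sub>L \<longrightarrow> cov = B\<^sub>L h M + B\<^sub>N h M) \<and>
       ((E\<^sub>L < D\<^sub>N \<and> D\<^sub>N < h \<and> h < D\<^sub>L) \<or> (D\<^sub>N < E\<^sub>L \<and> E\<^sub>L \<le> h \<and> h < D\<^sub>L) \<longrightarrow>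
          cov = A\<^sub>L h D\<^sub>L + B\<^sub>L D\<^sub>L M + B\<^sub>N h M) \<and>
       (E\<^sub>L < h \<and> h \<le> D\<^sub>N \<longrightarrow>
          cov = A\<^sub>L h D\<^sub>L + B\<^sub>L D\<^sub>L M + A\<^sub>N h D\<^sub>N + B\<^sub>N D\<^sub>N M) \<and>
       (D\<^sub>N \<le> h \<and> h < E\<^sub>L \<longrightarrow> cov = A\<^sub>L h M + B\<^sub>N h M) \<and>
       ((E\<^sub>N < h \<and> h \<le> E\<^sub>L \<and> E\<^sub>L < D\<^sub>N) \<or> (E\<^sub>N < h \<and> h < D\<^sub>N \<and> D\<^sub>N < E\<^sub>L) \<longrightarrow>
          cov = A\<^sub>L h M + A\<^sub>N h D\<^sub>N + B\<^sub>N D\<^sub>N M) \<and>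
       (h \<le> E\<^sub>N \<longrightarrow> cov = A\<^sub>L h M + A\<^sub>N h M)"
proof -
  interpret uplink_model Pr N X\<^sub>A X\<^sub>T K\<^sub>A K\<^sub>T G\<^sub>A G\<^sub>T by fact
  note cov = prob_coverage[OF assms(2)]
  note mixed = coverage_part_mixed[OF assms(2)]
  \<comment> \<open>Case (vi) compares h with E_N only: M \<le> D_N, and D_N < D_L then leaves the
    LOS link uncapped as well.\<close>
  have uncapped_LOS: "coverage_part \<gamma> LOS (height N) (max_length N) = A_int N \<gamma> LOS (height N) (max_length N)"
    if "height N \<le> E_lim N NLOS"
  proof (rule coverage_part_A)
    show "max_length N \<le> D_lim N LOS"
      using max_length_le_D_lim[OF that] height_le_max_length D_lim_less by linarith
  qed (simp_all add: height_le_max_length)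
  \<comment> \<open>Case (i), by contradiction: D_N \<ge> h would give D_N < D_L \<le> h.\<close>
  have capped_NLOS: "coverage_part \<gamma> NLOS (height N) (max_length N) = B_int N \<gamma> NLOS (height N) (max_length N)"
    if "D_lim N LOS \<le> height N"
    using that D_lim_less by (intro coverage_part_capped) linarith
  \<comment> \<open>Case (iii) says nothing about E_N; D_N \<le> M comes from D_N < D_L \<le>
    M.\<close>
  have mixed_NLOS: "coverage_part \<gamma> NLOS (height N) (max_length N) =
      A_int N \<gamma> NLOS (height N) (D_lim N NLOS) + B_int N \<gamma> NLOS (D_lim N NLOS) (max_length N)"
    if "E_lim N LOS < height N" "height N \<le> D_lim N NLOS"
    using that D_lim_less[OF that(2)] D_lim_le_max_length[of LOS] by (intro mixed) linarith+
  \<comment> \<open>Each case fixes one form per link state: capped, uncapped or mixed. In case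
    (iii), h \<le> D_L comes from D_N < D_L.\<close>
  show ?thesis
    unfolding Let_def cov
    using D_lim_less
    by (intro conjI impI; (elim disjE)?)
      (simp_all add: coverage_part_capped coverage_part_uncapped mixed D_lim_le_max_length
        uncapped_LOS capped_NLOS mixed_NLOS)
qed

end
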